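(* Let $H$ be a homogeneous relation on a finite set $X$, given by its matrix representation, and let $x\in X$. Then $MaxM(x)$ can be computed in $\Theta(Q(MaxM(x)))=O(|X|^2)$ time.
   Context: A diverse triple of $X$ is $(x,y,z)\in X^3$ with $x\neq y$, $x\neq z$, written $(x|yz)$. A homogeneous relation $H$ on $X$ is a relation on diverse triples such that for every $x\in X$ the relation $H_x(y,z)\Leftrightarrow H(x|yz)$ is an equivalence relation on $X\setminus\{x\}$. $M\subseteq X$ is a homogeneous module if $H(x|mm')$ for all $m,m'\in M$, $x\in X\setminus M$. $MaxM(x)$ is the unique partition of $X\setminus\{x\}$ into the inclusion-maximal homogeneous modules not containing $x$. For a partition $\mathcal P$ of a set, $Q(\mathcal P)$ is the number of unordered pairs $\{u,v\}$ of elements not in the same part of $\mathcal P$. Matrix representation: with $X=\{x_1,\dots,x_n\}$, an $n\times n$ matrix $A$ with entries in $\{1,\dots,n\}$ where the classes of each $H_{x_i}$ get distinct numbers and $A_{i,j}=k$ iff $x_j$ lies in the class of $H_{x_i}$ numbered $k$.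
   Formalization: When Q(MaxM(x)) = 0 (X∖{x} is empty or itself a module), time Θ(Q) = 0 is impossible, so there the running time is only claimed to be O(|X|); for Q(MaxM(x)) > 0 the bound Θ(Q(MaxM(x))) is as stated. *)

theory Defs
  imports Complex_Main "HOL-Library.Disjoint_Sets"
begin

section \<open>Homogeneous relations and modules\<close>

definition diverse_triple :: "'a set \<Rightarrow> 'a \<Rightarrow> 'a \<Rightarrow> 'a \<Rightarrow> bool" where
  "diverse_triple X x y z \<longleftrightarrow> x \<in> X \<and> y \<in> X \<and> z \<in> X \<and> x \<noteq> y \<and> x \<noteq> z"

definition section_rel :: "('a \<Rightarrow> 'a \<Rightarrow> 'a \<Rightarrow> bool) \<Rightarrow> 'a \<Rightarrow> ('a \<times> 'a) set" where
  "section_rel H x = {(y, z). H x y z}"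

definition homogeneous_relation :: "'a set \<Rightarrow> ('a \<Rightarrow> 'a \<Rightarrow> 'a \<Rightarrow> bool) \<Rightarrow> bool" where
  "homogeneous_relation X H \<longleftrightarrow>
     (\<forall>x y z. H x y z \<longrightarrow> diverse_triple X x y z) \<and>
     (\<forall>x\<in>X. equiv (X - {x}) (section_rel H x))"

definition homogeneous_module :: "'a set \<Rightarrow> ('a \<Rightarrow> 'a \<Rightarrow> 'a \<Rightarrow> bool) \<Rightarrow> 'a set \<Rightarrow> bool" where
  "homogeneous_module X H M \<longleftrightarrow>
     M \<subseteq> X \<and> (\<forall>m\<in>M. \<forall>m'\<in>M. \<forall>x\<in>X - M. H x m m')"

text \<open>
  The requirement that members be nonempty only matters for \<open>X = {x}\<close>, where the empty set is
  the sole module avoiding \<open>x\<close> but is not a part of any partition.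
\<close>

definition MaxM :: "'a set \<Rightarrow> ('a \<Rightarrow> 'a \<Rightarrow> 'a \<Rightarrow> bool) \<Rightarrow> 'a \<Rightarrow> 'a set set" where
  "MaxM X H x =
     {M. homogeneous_module X H M \<and> x \<notin> M \<and> M \<noteq> {} \<and>
         (\<forall>N. homogeneous_module X H N \<and> x \<notin> N \<and> M \<subseteq> N \<longrightarrow> N = M)}"

text \<open>
  \<open>Q P\<close> vanishes when \<open>P\<close> has at most one part. For \<open>P = MaxM X H x\<close> this is the case where
  \<open>X - {x}\<close> is empty or a module; a running time proportional to \<open>Q P\<close> is impossible there, and
  a linear one is best possible.
\<close>

definition Q :: "'a set set \<Rightarrow> nat" where
  "Q P = card {{u, v} |u v. u \<in> \<Union>P \<and> v \<in> \<Union>P \<and> \<not> (\<exists>C\<in>P. u \<in> C \<and> v \<in> C)}"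

lemma homogeneous_module_singleton:
  assumes "homogeneous_relation X H" "y \<in> X"
  shows "homogeneous_module X H {y}"
proof -
  have "H x y y" if "x \<in> X - {y}" for x
  proof -
    have "refl_on (X - {x}) (section_rel H x)"
      using assms(1) that by (auto simp: homogeneous_relation_def equiv_def)
    then have "(y, y) \<in> section_rel H x"
      using assms(2) that by (auto simp: refl_on_def)
    then show ?thesis by (simp add: section_rel_def)
  qed
  then show ?thesis using assms(2) by (auto simp: homogeneous_module_def)
qed

lemma homogeneous_module_Un:
  assumes H: "homogeneous_relation X H"
    and M: "homogeneous_module X H M" and N: "homogeneous_module X H N"
    and ne: "M \<inter> N \<noteq> {}"
  shows "homogeneous_module X H (M \<union> N)"
proof -
  obtain w where w: "w \<in> M" "w \<in> N" using ne by auto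
  have "H x m m'" if x: "x \<in> X - (M \<union> N)" and m: "m \<in> M \<union> N" "m' \<in> M \<union> N" for x m m'
  proof -
    have tr: "trans (section_rel H x)"
      using H x by (auto simp: homogeneous_relation_def equiv_def)
    have "H x m w" "H x w m'"
      using M N x m w by (auto simp: homogeneous_module_def)
    then show ?thesis
      using tr by (auto simp: trans_def section_rel_def)
  qed
  then show ?thesis
    using M N by (simp add: homogeneous_module_def)
qed

lemma MaxM_partition:
  assumes fin: "finite X" and H: "homogeneous_relation X H" and x: "x \<in> X"
  shows "partition_on (X - {x}) (MaxM X H x)"
proof (rule partition_onI)
  show "{} \<notin> MaxM X H x" by (simp add: MaxM_def)
  show "disjnt M N" if M: "M \<in> MaxM X H x" and N: "N \<in> MaxM X H x" and MN: "M \<noteq> N" for M N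
  proof (rule ccontr)
    assume "\<not> disjnt M N"
    then have un: "homogeneous_module X H (M \<union> N)"
      using homogeneous_module_Un[OF H] M N by (auto simp: MaxM_def disjnt_def)
    moreover have "x \<notin> M \<union> N" using M N by (auto simp: MaxM_def)
    ultimately have "M \<union> N = M" "M \<union> N = N"
      using M N unfolding MaxM_def by blast+
    then show False using MN by simp
  qed
  show "\<Union>(MaxM X H x) = X - {x}"
  proof
    show "\<Union>(MaxM X H x) \<subseteq> X - {x}" by (auto simp: MaxM_def homogeneous_module_def)
    show "X - {x} \<subseteq> \<Union>(MaxM X H x)"
    proof
      fix y assume y: "y \<in> X - {x}"
      let ?S = "{M. homogeneous_module X H M \<and> x \<notin> M}"
      have "finite ?S"
        by (rule finite_subset[of _ "Pow X"]) (auto simp: homogeneous_module_def fin)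
      moreover have "{y} \<in> ?S"
        using homogeneous_module_singleton[OF H] y by auto
      ultimately obtain M where "M \<in> ?S" "{y} \<subseteq> M" "\<And>N. N \<in> ?S \<Longrightarrow> M \<subseteq> N \<Longrightarrow> N = M"
        by (metis (no_types, lifting) finite_has_maximal2)
      then have "M \<in> MaxM X H x" "y \<in> M" by (auto simp: MaxM_def)
      then show "y \<in> \<Union>(MaxM X H x)" by blast
    qed
  qed
qed

section \<open>Matrix representation\<close>

text \<open>
  The list \<open>xs\<close> is the enumeration of \<open>X\<close>; positions, and the row and column indices of the
  matrix, start at \<open>0\<close>. As no class of \<open>H\<close> at \<open>xs ! i\<close> contains \<open>xs ! i\<close> itself, the diagonal entries
  are arbitrary elements of \<open>{1..n}\<close>.
\<close>

definition matrix_representation ::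
  "'a set \<Rightarrow> ('a \<Rightarrow> 'a \<Rightarrow> 'a \<Rightarrow> bool) \<Rightarrow> 'a list \<Rightarrow> (nat \<Rightarrow> nat \<Rightarrow> nat) \<Rightarrow> bool" where
  "matrix_representation X H xs A \<longleftrightarrow>
     distinct xs \<and> set xs = X \<and>
     (\<forall>i<length xs. \<forall>j<length xs. A i j \<in> {1..length xs}) \<and>
     (\<forall>i<length xs.
        let cls = (X - {xs ! i}) // section_rel H (xs ! i) in
        \<exists>num. num \<in> cls \<rightarrow> {1..length xs} \<and> inj_on num cls \<and>
          (\<forall>j<length xs. j \<noteq> i \<longrightarrow>
             (\<forall>k\<in>{1..length xs}. A i j = k \<longleftrightarrow> (\<exists>C\<in>cls. num C = k \<and> xs ! j \<in> C))))"

section \<open>Random access machine with unit cost\<close>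

text \<open>
  A machine has a program counter, registers and a main memory; all cells hold natural numbers.
  The first argument of each non-jump instruction except \<open>Store\<close> is the target register;
  \<open>Store a r\<close> writes the content of register \<open>r\<close> to the memory address held in register \<open>a\<close>.
  Subtraction is truncated. Every instruction takes one time unit; in the absence of a
  multiplication instruction, the unit-cost measure is the usual one.
\<close>

datatype instr =
    Const nat nat
  | Add nat nat nat
  | Sub nat nat nat
  | Load nat nat
  | Store nat nat
  | Jump nat
  | JumpZero nat nat

type_synonym program = "instr list"
type_synonym config = "nat \<times> (nat \<Rightarrow> nat) \<times> (nat \<Rightarrow> nat)"

fun exec :: "instr \<Rightarrow> config \<Rightarrow> config" where
  "exec (Const r k) (pc, R, M) = (Suc pc, R(r := k), M)"
| "exec (Add r a b) (pc, R, M) = (Suc pc, R(r := R a + R b), M)"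
| "exec (Sub r a b) (pc, R, M) = (Suc pc, R(r := R a - R b), M)"
| "exec (Load r a) (pc, R, M) = (Suc pc, R(r := M (R a)), M)"
| "exec (Store a r) (pc, R, M) = (Suc pc, R, M(R a := R r))"
| "exec (Jump l) (pc, R, M) = (l, R, M)"
| "exec (JumpZero r l) (pc, R, M) = (if R r = 0 then l else Suc pc, R, M)"

definition step :: "program \<Rightarrow> config \<Rightarrow> config \<Rightarrow> bool" where
  "step p c c' \<longleftrightarrow> fst c < length p \<and> c' = exec (p ! fst c) c"

text \<open>
  The machine halts when the program counter leaves the program. Since \<open>step p\<close> is deterministic
  and has no successor there, the number \<open>t\<close> of steps is unique.
\<close>

definition halts_in ::
  "program \<Rightarrow> (nat \<Rightarrow> nat) \<Rightarrow> (nat \<Rightarrow> nat) \<Rightarrow> nat \<Rightarrow> (nat \<Rightarrow> nat) \<Rightarrow> (nat \<Rightarrow> nat) \<Rightarrow> bool" where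
  "halts_in p R M t R' M' \<longleftrightarrow>
     (\<exists>pc. (step p ^^ t) (0, R, M) (pc, R', M') \<and> length p \<le> pc)"

section \<open>Input and output conventions\<close>

text \<open>
  Initially, register \<open>0\<close> holds the order \<open>n\<close> of the matrix, register \<open>1\<close> the position \<open>i\<close> of the
  chosen element, and the memory holds the matrix in row-major order from address \<open>0\<close>.
  All other cells are \<open>0\<close>.
\<close>

definition input_regs :: "nat \<Rightarrow> nat \<Rightarrow> nat \<Rightarrow> nat" where
  "input_regs n i = (\<lambda>_. 0)(0 := n, 1 := i)"

definition input_mem :: "nat \<Rightarrow> (nat \<Rightarrow> nat \<Rightarrow> nat) \<Rightarrow> nat \<Rightarrow> nat" where
  "input_mem n A a = (if a < n * n then A (a div n) (a mod n) else 0)"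

text \<open>
  On halting, register \<open>0\<close> holds the address of an array of \<open>n\<close> labels. Two positions other
  than \<open>i\<close> belong to the same part iff their labels agree; the label of \<open>i\<close> is ignored.
\<close>

definition output_partition ::
  "'a list \<Rightarrow> nat \<Rightarrow> (nat \<Rightarrow> nat) \<Rightarrow> (nat \<Rightarrow> nat) \<Rightarrow> 'a set set" where
  "output_partition xs i R M =
     (let J = {..<length xs} - {i}; lab = (\<lambda>j. M (R 0 + j)) in
      {{xs ! j |j. j \<in> J \<and> lab j = lab k} |k. k \<in> J})"

end

theory Submission
  imports Defs
begin

text \<open>
  A worklist holds pairs of a class \<open>C\<close> and a list \<open>L\<close> of pending pivots outside \<open>C\<close>, starting with
  \<open>(X - {x}, [x])\<close>; every element outside \<open>C\<close> and \<open>L\<close> already fails to distinguish the members of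
  \<open>C\<close>, and every module avoiding \<open>x\<close> and meeting \<open>C\<close> lies in \<open>C\<close>. The first pivot \<open>y\<close> divides
  \<open>C\<close> into the \<open>H\<^sub>y\<close>-class \<open>C1\<close> of its first member and the rest \<open>C2\<close>. Then \<open>y\<close> is retired for \<open>C1\<close>
  but stays pending for \<open>C2\<close>, and the members of \<open>C1\<close> and \<open>C2\<close> become pivots for each other. Classes
  without pivots are maximal modules.

  Such a step takes time \<open>\<Theta>(|C|)\<close>, while \<open>\<Sum>(|C| |L| + |C|\<^sup>2)\<close> drops by exactly \<open>|C1|\<close> and
  \<open>|C2| \<le> |C1| |C2|\<close>, the number of pairs newly separated. As \<open>2 Q P + \<Sum>|C|\<^sup>2 = (n - 1)\<^sup>2\<close> for the final
  partition \<open>P\<close>, the total time is \<open>\<Theta>(n + Q P)\<close>, and \<open>n \<le> 3 Q P\<close> unless \<open>Q P = 0\<close>.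
\<close>

subsection \<open>Counting separated pairs\<close>

text \<open>The map from \<open>(u, v)\<close> to \<open>{u, v}\<close> has fibres of exactly two
  elements, \<open>(u, v)\<close> and \<open>(v, u)\<close>.\<close>

lemma card_ordered_pairs:
  assumes "finite S" "\<And>u v. (u, v) \<in> S \<Longrightarrow> (v, u) \<in> S \<and> u \<noteq> v"
  shows "card S = 2 * card {{u, v} |u v. (u, v) \<in> S}"
proof -
  let ?E = "{{u, v} |u v. (u, v) \<in> S}"
  let ?F = "\<lambda>e. {(u, v). (u, v) \<in> S \<and> {u, v} = e}"
  have E: "?E = (\<lambda>(u, v). {u, v}) ` S" by auto
  then have fin: "finite ?E" using assms(1) by simp
  have "card (?F e) = 2" if e: "e \<in> ?E" for e
  proof -
    obtain u v where uv: "e = {u, v}" "(u, v) \<in> S" using e by blast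
    then have "?F e = {(u, v), (v, u)}" using assms(2) by (auto simp: doubleton_eq_iff)
    then show ?thesis using assms(2) uv by auto
  qed
  moreover have "S = (\<Union>e\<in>?E. ?F e)" by auto
  moreover have "card (\<Union>e\<in>?E. ?F e) = (\<Sum>e\<in>?E. card (?F e))"
    using fin by (intro card_UN_disjoint) (auto intro: finite_subset[OF _ assms(1)])
  ultimately show ?thesis by simp
qed

text \<open>\<open>Y \<times> Y\<close> splits into the separated ordered pairs, two for each
  unordered one, and the squares \<open>C \<times> C\<close> of the parts.\<close>

lemma Q_sum_squares:
  assumes "finite Y" "partition_on Y P"
  shows "2 * Q P + (\<Sum>C\<in>P. (card C)\<^sup>2) = (card Y)\<^sup>2"
proof -
  have Y: "\<Union>P = Y" using assms(2) by (simp add: partition_on_def)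
  have P: "finite P" using finite_elements[OF assms] .
  have C: "finite C" if "C \<in> P" for C using that Y assms(1) by (auto intro: finite_subset)
  let ?S = "{(u, v). u \<in> Y \<and> v \<in> Y \<and> \<not> (\<exists>C\<in>P. u \<in> C \<and> v \<in> C)}"
  have S: "?S \<subseteq> Y \<times> Y" by auto
  then have fin: "finite ?S" using assms(1) by (auto intro: finite_subset)
  have "card ?S = 2 * card {{u, v} |u v. (u, v) \<in> ?S}"
    using fin by (rule card_ordered_pairs) (use Y in auto)
  then have "card ?S = 2 * Q P" by (simp add: Q_def Y)
  moreover have "card (\<Union>C\<in>P. C \<times> C) = (\<Sum>C\<in>P. card (C \<times> C))"
  proof (rule card_UN_disjoint[OF P])
    show "\<forall>C\<in>P. finite (C \<times> C)" using C by simp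
    show "\<forall>C\<in>P. \<forall>D\<in>P. C \<noteq> D \<longrightarrow> C \<times> C \<inter> D \<times> D = {}"
      using assms(2) by (auto simp: partition_on_def disjoint_def)
  qed
  moreover have "Y \<times> Y = ?S \<union> (\<Union>C\<in>P. C \<times> C)" using Y by auto
  moreover have "card (?S \<union> (\<Union>C\<in>P. C \<times> C)) = card ?S + card (\<Union>C\<in>P. C \<times> C)"
    using fin P C by (intro card_Un_disjoint) auto
  ultimately have "card (Y \<times> Y) = 2 * Q P + (\<Sum>C\<in>P. card (C \<times> C))" by simp
  then show ?thesis by (simp add: card_cartesian_product power2_eq_square)
qed

text \<open>Lets a linear cost be absorbed into \<open>Q P\<close>. Once \<open>u\<close> and
  \<open>v\<close> are separated, no \<open>w\<close> shares a part with both, so each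
  \<open>w\<close> other than \<open>u\<close> gives a separated pair with \<open>u\<close> or with
  \<open>v\<close>, and these pairs are distinct.\<close>

lemma card_le_Suc_Q:
  assumes "finite Y" "partition_on Y P" "Q P \<noteq> 0"
  shows "card Y \<le> Q P + 1"
proof -
  have Y: "\<Union>P = Y" using assms(2) by (simp add: partition_on_def)
  define sep where "sep u v \<longleftrightarrow> \<not> (\<exists>C\<in>P. u \<in> C \<and> v \<in> C)" for u v
  let ?E = "{{u, v} |u v. u \<in> Y \<and> v \<in> Y \<and> sep u v}"
  have Q: "Q P = card ?E" by (simp add: Q_def Y sep_def)
  with assms(3) have E: "finite ?E" "?E \<noteq> {}" by (auto simp: card_gt_0_iff)
  then obtain u v where uv: "u \<in> Y" "v \<in> Y" "sep u v" by blast
  have irr: "\<not> sep w w" if "w \<in> Y" for w using that Y by (auto simp: sep_def)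
  have sep: "sep u w \<or> sep v w" if "w \<in> Y" for w
    using uv assms(2) unfolding sep_def partition_on_def disjoint_def by blast
  let ?f = "\<lambda>w. if sep u w then {u, w} else {v, w}"
  have "card (Y - {u}) \<le> card ?E"
  proof (rule card_inj_on_le[OF _ _ E(1)])
    show "inj_on ?f (Y - {u})"
      by (rule inj_onI) (use uv irr in \<open>auto simp: doubleton_eq_iff split: if_splits\<close>)
    show "?f ` (Y - {u}) \<subseteq> ?E" using uv sep by fastforce
  qed
  then show ?thesis using Q uv(1) assms(1) by simp
qed

subsection \<open>Partition refinement\<close>

text \<open>The list order mirrors the machine: \<open>rev\<close> comes from pushing members onto
  the front, and both new pivot lists extend the old one, which can thus be shared instead of
  copied. Empty classes arise as \<open>C2\<close> when \<open>y\<close> does not distinguish the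
  members.\<close>

function solve ::
  "(nat \<Rightarrow> nat \<Rightarrow> nat) \<Rightarrow> (nat list \<times> nat list) list \<Rightarrow> nat list list" where
  "solve A [] = []"
| "solve A (([], L) # W) = solve A W"
| "solve A ((c # C, []) # W) = (c # C) # solve A W"
| "solve A ((c # C, y # L) # W) =
     (let C1 = rev (filter (\<lambda>z. A y z = A y c) (c # C));
          C2 = rev (filter (\<lambda>z. A y z \<noteq> A y c) (c # C))
      in solve A ((C1, C2 @ L) # (C2, C1 @ y # L) # W))"
  by pat_completeness auto

section \<open>Potentials for termination and running time\<close>

lemma length_filter_split:
  "length C = length (filter P C) + length (filter (\<lambda>z. \<not> P z) C)"
  using sum_length_filter_compl[of P C] by simp

text \<open>The value that the potential \<open>lower\<close> takes once all pivot lists are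
  empty.\<close>

definition sq :: "nat list list \<Rightarrow> nat" where
  "sq D = (\<Sum>C\<leftarrow>D. (length C)\<^sup>2)"

definition lower :: "(nat list \<times> nat list) list \<Rightarrow> nat" where
  "lower W = (\<Sum>(C, L)\<leftarrow>W. length C * length L + (length C)\<^sup>2)"

text \<open>
  Dividing a class \<open>C\<close> takes \<open>27 |C| + 34\<close> instructions, discarding an empty one \<open>7\<close> and labelling
  a final one \<open>8 |C| + 10\<close>.
\<close>

definition upper :: "(nat list \<times> nat list) list \<Rightarrow> nat" where
  "upper W = (\<Sum>(C, L)\<leftarrow>W. 68 * (length C * length L) + 82 * (length C)\<^sup>2 + 11 * length C + 7)"

text \<open>The cross term \<open>2 * |C1| * |C2|\<close> of \<open>|C|\<^sup>2\<close> reappears as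
  the new pending pairs between the two halves. Only the pairs of \<open>y\<close> with members of
  \<open>C1\<close> disappear.\<close>

lemma lower_split:
  assumes "length C = length C1 + length C2"
  shows "lower ((C, y # L) # W) = lower ((C1, C2 @ L) # (C2, C1 @ y # L) # W) + length C1"
  by (simp add: lower_def assms power2_eq_square algebra_simps)

text \<open>The potential drops by \<open>68 * |C1| + 28 * |C1| * |C2| - 7\<close>, the 7 being due
  to the additional entry. As \<open>C1\<close> is nonempty, the product covers
  \<open>27 * |C2|\<close>, and \<open>68 * |C1|\<close> covers
  \<open>27 * |C1| + 34 + 7\<close>.\<close>

lemma upper_split:
  assumes "length C = length C1 + length C2" "C1 \<noteq> []"
  shows "upper ((C1, C2 @ L) # (C2, C1 @ y # L) # W) + (27 * length C + 34)
    \<le> upper ((C, y # L) # W)"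
proof -
  obtain a where "length C1 = Suc a" using assms(2) by (cases C1) auto
  then show ?thesis by (simp add: upper_def assms(1) power2_eq_square algebra_simps)
qed

termination
\<comment> \<open>A division lowers \<open>lower\<close> by at least 1 but lengthens the worklist by
  1, hence the factor 2.\<close>
proof (relation "measure (\<lambda>(A, W). 2 * lower W + length W)")
  fix A :: "nat \<Rightarrow> nat \<Rightarrow> nat" and c C y L W C1 C2
  assume C1: "C1 = rev (filter (\<lambda>z. A y z = A y c) (c # C))"
    and C2: "C2 = rev (filter (\<lambda>z. A y z \<noteq> A y c) (c # C))"
  have "length (c # C) = length C1 + length C2"
    unfolding C1 C2 length_rev by (rule length_filter_split)
  note lower_split[OF this, of y L W]
  moreover have "C1 \<noteq> []" by (simp add: C1)
  then obtain b B where "C1 = b # B" by (cases C1) simp_all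
  ultimately show "((A, (C1, C2 @ L) # (C2, C1 @ y # L) # W), A, (c # C, y # L) # W)
    \<in> measure (\<lambda>(A, W). 2 * lower W + length W)"
    by simp
qed (simp_all add: lower_def)

text \<open>Models the label array: \<open>f\<close> is its content before, and \<open>D\<close>
  lists the classes in the order in which the machine labels them.\<close>

definition relabel :: "(nat \<Rightarrow> nat) \<Rightarrow> nat list list \<Rightarrow> nat \<Rightarrow> nat" where
  "relabel f D = fold (\<lambda>C g z. if z \<in> set C then hd C else g z) D f"

lemma relabel_Cons: "relabel f (C # D) = relabel (\<lambda>z. if z \<in> set C then hd C else f z) D"
  by (simp add: relabel_def)

lemma relabel_cong: "f z = g z \<Longrightarrow> relabel f D z = relabel g D z"
proof (induction D arbitrary: f g)
  case Nil
  then show ?case by (simp add: relabel_def)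
next
  case (Cons C D)
  show ?case unfolding relabel_Cons by (rule Cons.IH) (simp add: Cons.prems)
qed

section \<open>Modules as sets of positions and the refinement invariant\<close>

text \<open>The numbering of the classes is injective, so equal entries mean equal classes. The
  diagonal is excluded, its entries being arbitrary.\<close>

lemma matrix_representation_iff:
  assumes H: "homogeneous_relation X H" and rep: "matrix_representation X H xs A"
    and "y < length xs" "z < length xs" "w < length xs" "z \<noteq> y" "w \<noteq> y"
  shows "H (xs ! y) (xs ! z) (xs ! w) \<longleftrightarrow> A y z = A y w"
proof -
  let ?r = "section_rel H (xs ! y)"
  let ?cls = "(X - {xs ! y}) // ?r"
  have y: "xs ! y \<in> X" using rep assms(3) by (auto simp: matrix_representation_def)
  then have eq: "equiv (X - {xs ! y}) ?r"
    using H by (auto simp: homogeneous_relation_def)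
  have A: "\<forall>i<length xs. \<forall>j<length xs. A i j \<in> {1..length xs}"
    using rep by (simp add: matrix_representation_def)
  obtain num where num: "inj_on num ?cls"
    "\<forall>j<length xs. j \<noteq> y \<longrightarrow>
      (\<forall>k\<in>{1..length xs}. A y j = k \<longleftrightarrow> (\<exists>C\<in>?cls. num C = k \<and> xs ! j \<in> C))"
    using rep assms(3) unfolding matrix_representation_def Let_def by blast
  obtain C where C: "C \<in> ?cls" "num C = A y z" "xs ! z \<in> C"
    using num(2) A assms(3,4,6) by blast
  obtain D where D: "D \<in> ?cls" "num D = A y w" "xs ! w \<in> D"
    using num(2) A assms(3,5,7) by blast
  have "A y z = A y w \<longleftrightarrow> C = D" using inj_on_eq_iff[OF num(1) C(1) D(1)] C(2) D(2) by simp
  also have "\<dots> \<longleftrightarrow> (xs ! z, xs ! w) \<in> ?r"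
    using quotient_eq_iff[OF eq C(1) D(1) C(3) D(3)] .
  finally show ?thesis by (simp add: section_rel_def)
qed

text \<open>As \<open>y\<close> lies outside \<open>M\<close>, no diagonal entry is ever
  compared.\<close>

definition index_module :: "nat \<Rightarrow> (nat \<Rightarrow> nat \<Rightarrow> nat) \<Rightarrow> nat set \<Rightarrow> bool" where
  "index_module n A M \<longleftrightarrow>
     M \<subseteq> {..<n} \<and> (\<forall>z\<in>M. \<forall>w\<in>M. \<forall>y\<in>{..<n} - M. A y z = A y w)"

lemma homogeneous_module_image_iff:
  assumes "homogeneous_relation X H" "matrix_representation X H xs A" "M \<subseteq> {..<length xs}"
  shows "homogeneous_module X H ((!) xs ` M) \<longleftrightarrow> index_module (length xs) A M"
proof -
  have xs: "distinct xs" "set xs = X"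
    using assms(2) by (auto simp: matrix_representation_def)
  have X: "X - (!) xs ` M = (!) xs ` ({..<length xs} - M)"
  proof -
    have "inj_on ((!) xs) {..<length xs}" using xs(1) by (simp add: inj_on_nth)
    from inj_on_image_set_diff[OF this _ assms(3)] show ?thesis
      using xs(2) by (simp add: nth_image lessThan_atLeast0)
  qed
  have "(\<forall>z\<in>M. \<forall>w\<in>M. \<forall>y\<in>{..<length xs} - M. H (xs ! y) (xs ! z) (xs ! w)) \<longleftrightarrow>
    (\<forall>z\<in>M. \<forall>w\<in>M. \<forall>y\<in>{..<length xs} - M. A y z = A y w)"
    using assms(3) by (intro ball_cong refl matrix_representation_iff[OF assms(1,2)]) auto
  moreover have "(!) xs ` M \<subseteq> X" using assms(3) xs(2) by auto
  ultimately show ?thesis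
    unfolding homogeneous_module_def index_module_def X using assms(3) by simp
qed

text \<open>The invariant of a worklist entry. For \<open>L = []\<close> the third conjunct makes
  \<open>set C\<close> a module, and the last one puts every module that avoids \<open>i\<close> and
  meets \<open>set C\<close> inside it.\<close>

definition good :: "nat \<Rightarrow> (nat \<Rightarrow> nat \<Rightarrow> nat) \<Rightarrow> nat \<Rightarrow> nat list \<Rightarrow> nat list \<Rightarrow> bool" where
  "good n A i C L \<longleftrightarrow> set C \<subseteq> {..<n} - {i} \<and> set L \<subseteq> {..<n} - set C \<and>
     (\<forall>z\<in>set C. \<forall>w\<in>set C. \<forall>y\<in>{..<n} - set C - set L. A y z = A y w) \<and>
     (\<forall>M. index_module n A M \<longrightarrow> i \<notin> M \<longrightarrow> M \<inter> set C \<noteq> {} \<longrightarrow> M \<subseteq> set C)"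

text \<open>A module inside \<open>C\<close> does not contain \<open>y\<close>, so row
  \<open>y\<close> is constant on it and it falls into one half. Row \<open>y\<close> is constantly
  \<open>k\<close> on the first half, where \<open>y\<close> is retired; on the other half several
  values may remain.\<close>

lemma good_split:
  assumes "good n A i C (y # L)"
  shows "good n A i (rev (filter (\<lambda>z. A y z = k) C)) (rev (filter (\<lambda>z. A y z \<noteq> k) C) @ L)"
    and "good n A i (rev (filter (\<lambda>z. A y z \<noteq> k) C)) (rev (filter (\<lambda>z. A y z = k) C) @ y # L)"
proof -
  have C: "set C \<subseteq> {..<n} - {i}" "y \<in> {..<n} - set C" "set L \<subseteq> {..<n} - set C"
    using assms unfolding good_def by simp_all
  have unif: "\<And>z w v. z \<in> set C \<Longrightarrow> w \<in> set C \<Longrightarrow> v \<in> {..<n} - set C - set (y # L) \<Longrightarrow>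
      A v z = A v w"
    using conjunct1[OF conjunct2[OF conjunct2[OF assms[unfolded good_def]]]] by blast
  have mod: "\<And>M. index_module n A M \<Longrightarrow> i \<notin> M \<Longrightarrow> M \<inter> set C \<noteq> {} \<Longrightarrow> M \<subseteq> set C"
    using conjunct2[OF conjunct2[OF conjunct2[OF assms[unfolded good_def]]]] by blast
  have M: "M \<subseteq> set C \<and> (\<forall>z\<in>M. \<forall>w\<in>M. A y z = A y w)"
    if "index_module n A M" "i \<notin> M" "M \<inter> set C \<noteq> {}" for M
  proof -
    have "M \<subseteq> set C" using mod[OF that] .
    then have "y \<in> {..<n} - M" using C(2) by auto
    then show ?thesis using \<open>M \<subseteq> set C\<close> that(1) unfolding index_module_def by blast
  qed
  show "good n A i (rev (filter (\<lambda>z. A y z = k) C)) (rev (filter (\<lambda>z. A y z \<noteq> k) C) @ L)"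
    unfolding good_def
  proof (intro conjI allI impI)
    show "\<forall>z\<in>set (rev (filter (\<lambda>z. A y z = k) C)). \<forall>w\<in>set (rev (filter (\<lambda>z. A y z = k) C)).
      \<forall>v\<in>{..<n} - set (rev (filter (\<lambda>z. A y z = k) C)) - set (rev (filter (\<lambda>z. A y z \<noteq> k) C) @ L).
        A v z = A v w"
    proof (intro ballI)
      fix z w v
      assume z: "z \<in> set (rev (filter (\<lambda>z. A y z = k) C))"
        and w: "w \<in> set (rev (filter (\<lambda>z. A y z = k) C))"
        and v: "v \<in> {..<n} - set (rev (filter (\<lambda>z. A y z = k) C)) -
          set (rev (filter (\<lambda>z. A y z \<noteq> k) C) @ L)"
      show "A v z = A v w"
      \<comment> \<open>Only the retired pivot is not covered by \<open>unif\<close>.\<close>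
      proof (cases "v = y")
        case True
        then show ?thesis using z w by simp
      next
        case False
        show ?thesis by (rule unif) (use z w v False in auto)
      qed
    qed
    show "M \<subseteq> set (rev (filter (\<lambda>z. A y z = k) C))"
      if "index_module n A M" "i \<notin> M" "M \<inter> set (rev (filter (\<lambda>z. A y z = k) C)) \<noteq> {}" for M
    proof -
      note ne = that(3)
      obtain z where z: "z \<in> M" "z \<in> set C" "A y z = k"
        using ne unfolding set_rev set_filter by blast
      then have "M \<inter> set C \<noteq> {}" by blast
      note M[OF that(1,2) this]
      then have w: "w \<in> set C" "A y w = A y z" if "w \<in> M" for w using z(1) that by blast+
      show ?thesis
      proof
        fix w assume "w \<in> M"
        from w[OF this] z(3) show "w \<in> set (rev (filter (\<lambda>z. A y z = k) C))" by simp
      qed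
    qed
  qed (use C in auto)
  show "good n A i (rev (filter (\<lambda>z. A y z \<noteq> k) C)) (rev (filter (\<lambda>z. A y z = k) C) @ y # L)"
    unfolding good_def
  proof (intro conjI allI impI)
    show "\<forall>z\<in>set (rev (filter (\<lambda>z. A y z \<noteq> k) C)). \<forall>w\<in>set (rev (filter (\<lambda>z. A y z \<noteq> k) C)).
      \<forall>v\<in>{..<n} - set (rev (filter (\<lambda>z. A y z \<noteq> k) C)) -
        set (rev (filter (\<lambda>z. A y z = k) C) @ y # L). A v z = A v w"
      by (intro ballI unif) auto
    show "M \<subseteq> set (rev (filter (\<lambda>z. A y z \<noteq> k) C))"
      if "index_module n A M" "i \<notin> M" "M \<inter> set (rev (filter (\<lambda>z. A y z \<noteq> k) C)) \<noteq> {}" for M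
    proof -
      note ne = that(3)
      obtain z where z: "z \<in> M" "z \<in> set C" "A y z \<noteq> k"
        using ne unfolding set_rev set_filter by blast
      then have "M \<inter> set C \<noteq> {}" by blast
      note M[OF that(1,2) this]
      then have w: "w \<in> set C" "A y w = A y z" if "w \<in> M" for w using z(1) that by blast+
      show ?thesis
      proof
        fix w assume "w \<in> M"
        from w[OF this] z(3) show "w \<in> set (rev (filter (\<lambda>z. A y z \<noteq> k) C))" by simp
      qed
    qed
  qed (use C in auto)
qed

lemma solve_good:
  assumes "\<forall>(C, L)\<in>set W. good n A i C L" "distinct (concat (map fst W))"
  shows "set (concat (solve A W)) = set (concat (map fst W)) \<and> distinct (concat (solve A W)) \<and>
    (\<forall>C\<in>set (solve A W). C \<noteq> [] \<and> good n A i C [])"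
  using assms
proof (induction A W rule: solve.induct)
  case (4 A c C y L W)
  let ?C = "c # C"
  let ?C1 = "rev (filter (\<lambda>z. A y z = A y c) ?C)" and ?C2 = "rev (filter (\<lambda>z. A y z \<noteq> A y c) ?C)"
  let ?W = "(?C1, ?C2 @ L) # (?C2, ?C1 @ y # L) # W"
  have "good n A i ?C (y # L)" using 4(2) by simp
  note good_split[OF this, of "A y c"]
  then have "\<forall>(C, L)\<in>set ?W. good n A i C L" using 4(2) by simp
  moreover have set: "set (concat (map fst ?W)) = set (concat (map fst ((?C, y # L) # W)))"
    by auto
  moreover have "distinct (concat (map fst ?W))"
    using 4(3) by auto
  ultimately have "set (concat (solve A ?W)) = set (concat (map fst ?W)) \<and>
    distinct (concat (solve A ?W)) \<and> (\<forall>C\<in>set (solve A ?W). C \<noteq> [] \<and> good n A i C [])"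
    by (intro 4(1)[OF refl refl])
  then show ?case unfolding set solve.simps Let_def .
qed auto

lemma relabel_notin: "z \<notin> set (concat D) \<Longrightarrow> relabel f D z = f z"
  by (induction D arbitrary: f) (simp_all add: relabel_def)

lemma relabel_in:
  "distinct (concat D) \<Longrightarrow> C \<in> set D \<Longrightarrow> z \<in> set C \<Longrightarrow> relabel f D z = hd C"
proof (induction D arbitrary: f)
  case (Cons B D)
  show ?case
  proof (cases "C = B")
    case True
    then have "z \<notin> set (concat D)" using Cons.prems by auto
    then show ?thesis using True Cons.prems by (simp add: relabel_Cons relabel_notin)
  next
    case False
    then show ?thesis using Cons by (simp add: relabel_Cons)
  qed
qed simp

section \<open>Correctness of the computed partition\<close>

text \<open>A class is a module containing every module that avoids \<open>i\<close> and meets it,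
  hence maximal. Conversely, a maximal module is nonempty, so it meets some class, lies in it, and
  equals it by maximality.\<close>

lemma MaxM_eq_classes:
  assumes H: "homogeneous_relation X H" and rep: "matrix_representation X H xs A"
    and i: "i < length xs"
    and D: "set (concat D) = {..<length xs} - {i}"
      "\<And>C. C \<in> set D \<Longrightarrow> C \<noteq> [] \<and> good (length xs) A i C []"
  shows "MaxM X H (xs ! i) = (\<lambda>C. (!) xs ` set C) ` set D"
proof -
  let ?n = "length xs"
  have xs: "distinct xs" "set xs = X" using rep by (auto simp: matrix_representation_def)
  have inj: "inj_on ((!) xs) {..<?n}" using xs(1) by (simp add: inj_on_nth)
  have notin: "xs ! i \<in> (!) xs ` I \<longleftrightarrow> i \<in> I" if "I \<subseteq> {..<?n}" for I
    using inj_on_image_mem_iff[OF inj _ that] i by simp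
  have cls: "set C \<subseteq> {..<?n}" "i \<notin> set C" "set C \<noteq> {}" "index_module ?n A (set C)"
    "\<And>I. index_module ?n A I \<Longrightarrow> i \<notin> I \<Longrightarrow> I \<inter> set C \<noteq> {} \<Longrightarrow> I \<subseteq> set C"
    if "C \<in> set D" for C
    using D(2)[OF that] unfolding good_def index_module_def
    by (simp_all only: list.set Diff_empty set_empty) blast+
  have pull: "\<exists>I\<subseteq>{..<?n}. M = (!) xs ` I \<and> index_module ?n A I \<and> i \<notin> I"
    if "homogeneous_module X H M" "xs ! i \<notin> M" for M
  proof -
    have "M \<subseteq> X" using that(1) by (simp add: homogeneous_module_def)
    then have "M \<subseteq> (!) xs ` {..<?n}" using xs(2) by (simp add: nth_image lessThan_atLeast0)
    then obtain I where I: "I \<subseteq> {..<?n}" "M = (!) xs ` I" by (auto simp: subset_image_iff)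
    then show ?thesis
      using that notin[OF I(1)] homogeneous_module_image_iff[OF H rep I(1)] by auto
  qed
  have max: "(!) xs ` set C \<in> MaxM X H (xs ! i)" if C: "C \<in> set D" for C
    unfolding MaxM_def
  proof (intro CollectI conjI allI impI)
    show "homogeneous_module X H ((!) xs ` set C)"
      using homogeneous_module_image_iff[OF H rep] cls[OF C] by simp
    show "xs ! i \<notin> (!) xs ` set C" using notin cls[OF C] by simp
    show "(!) xs ` set C \<noteq> {}" using cls(3)[OF C] by simp
    fix N assume N: "homogeneous_module X H N \<and> xs ! i \<notin> N \<and> (!) xs ` set C \<subseteq> N"
    then obtain I where I: "I \<subseteq> {..<?n}" "N = (!) xs ` I" "index_module ?n A I" "i \<notin> I"
      using pull by blast
    have "set C \<subseteq> I"
    proof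
      fix z assume "z \<in> set C"
      then show "z \<in> I" using N I(2) cls(1)[OF C] inj_on_image_mem_iff[OF inj _ I(1)] by blast
    qed
    then have "I \<inter> set C = set C" by (rule Int_absorb1)
    with cls(3)[OF C] have "I \<inter> set C \<noteq> {}" by (simp only: not_False_eq_True)
    from cls(5)[OF C I(3,4) this] have "I \<subseteq> set C" .
    then show "N = (!) xs ` set C" using \<open>set C \<subseteq> I\<close> I(2) by auto
  qed
  show ?thesis
  proof
    show "(\<lambda>C. (!) xs ` set C) ` set D \<subseteq> MaxM X H (xs ! i)" using max by blast
    show "MaxM X H (xs ! i) \<subseteq> (\<lambda>C. (!) xs ` set C) ` set D"
    proof
      fix M assume M: "M \<in> MaxM X H (xs ! i)"
      then have "homogeneous_module X H M" "xs ! i \<notin> M" "M \<noteq> {}" by (simp_all add: MaxM_def)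
      then obtain I where I: "I \<subseteq> {..<?n}" "M = (!) xs ` I" "index_module ?n A I" "i \<notin> I"
        using pull by blast
      obtain z where z: "z \<in> I" using I(2) \<open>M \<noteq> {}\<close> by blast
      then have "z \<in> set (concat D)" using I(1,4) D(1) by auto
      then obtain C where C: "C \<in> set D" "z \<in> set C" by auto
      have "I \<inter> set C \<noteq> {}" using z C(2) by blast
      from cls(5)[OF C(1) I(3,4) this] have "I \<subseteq> set C" .
      then have "M \<subseteq> (!) xs ` set C" using I(2) by blast
      then have "(!) xs ` set C = M" using M max[OF C(1)] by (simp add: MaxM_def)
      then show "M \<in> (\<lambda>C. (!) xs ` set C) ` set D" using C(1) by blast
    qed
  qed
qed

text \<open>The classes are nonempty and disjoint, so their first members are distinct and can serve
  as labels.\<close>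

lemma output_partition_eq_classes:
  assumes D: "set (concat D) = {..<length xs} - {i}" "distinct (concat D)" "[] \<notin> set D"
    and M: "\<forall>z<length xs. M (R 0 + z) = relabel f D z"
  shows "output_partition xs i R M = (\<lambda>C. (!) xs ` set C) ` set D"
proof -
  let ?J = "{..<length xs} - {i}"
  let ?B = "\<lambda>k. {xs ! j |j. j \<in> ?J \<and> M (R 0 + j) = M (R 0 + k)}"
  have lab: "M (R 0 + z) = hd C" if "C \<in> set D" "z \<in> set C" for C z
  proof -
    have "z \<in> ?J" using that D(1) by auto
    then show ?thesis using M relabel_in[OF D(2) that] by simp
  qed
  have hd: "C = C'" if "C \<in> set D" "C' \<in> set D" "hd C = hd C'" for C C'
  proof (rule ccontr)
    assume ne: "C \<noteq> C'"
    have "set C \<inter> set C' = {}"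
      using D(2) that(1,2) ne by (simp add: distinct_concat_iff)
    moreover have "hd C \<in> set C" "hd C' \<in> set C'" using D(3) that(1,2) by (metis hd_in_set)+
    ultimately show False using that(3) by auto
  qed
  have B: "?B k = (!) xs ` set C" if C: "C \<in> set D" "k \<in> set C" for C k
  proof -
    have "j \<in> ?J \<and> M (R 0 + j) = M (R 0 + k) \<longleftrightarrow> j \<in> set C" for j
    proof
      assume j: "j \<in> ?J \<and> M (R 0 + j) = M (R 0 + k)"
      then have "j \<in> set (concat D)" using D(1) by simp
      then obtain C' where "C' \<in> set D" "j \<in> set C'" by auto
      moreover from this have "C' = C" using j lab C by (intro hd) auto
      ultimately show "j \<in> set C" by simp
    next
      assume "j \<in> set C"
      then show "j \<in> ?J \<and> M (R 0 + j) = M (R 0 + k)" using C lab D(1) by auto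
    qed
    then show ?thesis by auto
  qed
  have "output_partition xs i R M = ?B ` ?J" unfolding output_partition_def Let_def by auto
  also have "\<dots> = (\<lambda>C. (!) xs ` set C) ` set D"
  proof
    show "?B ` ?J \<subseteq> (\<lambda>C. (!) xs ` set C) ` set D"
    proof
      fix S assume "S \<in> ?B ` ?J"
      then obtain k where k: "k \<in> ?J" "S = ?B k" by blast
      then have "k \<in> set (concat D)" using D(1) by simp
      then obtain C where "C \<in> set D" "k \<in> set C" by auto
      then show "S \<in> (\<lambda>C. (!) xs ` set C) ` set D" using k(2) B by blast
    qed
    show "(\<lambda>C. (!) xs ` set C) ` set D \<subseteq> ?B ` ?J"
    proof
      fix S assume "S \<in> (\<lambda>C. (!) xs ` set C) ` set D"
      then obtain C where C: "C \<in> set D" "S = (!) xs ` set C" by blast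
      then have "hd C \<in> set C" using D(3) by (auto intro!: hd_in_set)
      then have "hd C \<in> ?J" "S = ?B (hd C)" using C D(1) B[OF C(1)] by auto
      then show "S \<in> ?B ` ?J" by blast
    qed
  qed
  finally show ?thesis .
qed

text \<open>Connects the potential with \<open>Q_sum_squares\<close>. Classes with equal images
  would have equal sets; being disjoint and nonempty, they must coincide, so nothing is lost in
  passing from the list to the set of parts.\<close>

lemma sq_eq_sum_card:
  assumes D: "distinct (concat D)" "[] \<notin> set D" "set (concat D) \<subseteq> {..<length xs}" and "distinct xs"
  shows "(\<Sum>B\<in>(\<lambda>C. (!) xs ` set C) ` set D. (card B)\<^sup>2) = sq D"
proof -
  have inj: "inj_on ((!) xs) {..<length xs}" using assms(4) by (simp add: inj_on_nth)
  have sub: "set C \<subseteq> {..<length xs}" if "C \<in> set D" for C using that D(3) by auto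
  have dist: "distinct D" using D(1,2) by (simp add: distinct_concat_iff removeAll_id)
  have "inj_on (\<lambda>C. (!) xs ` set C) (set D)"
  proof (rule inj_onI)
    fix C C' assume C: "C \<in> set D" "C' \<in> set D" "(!) xs ` set C = (!) xs ` set C'"
    then have "set C = set C'" using inj sub by (simp add: inj_on_image_eq_iff)
    then show "C = C'" using D(1,2) C(1,2)
      by (metis distinct_concat_iff inf.idem set_empty)
  qed
  then have "(\<Sum>B\<in>(\<lambda>C. (!) xs ` set C) ` set D. (card B)\<^sup>2) = (\<Sum>C\<in>set D. (card ((!) xs ` set C))\<^sup>2)"
    by (simp add: sum.reindex)
  also have "\<dots> = (\<Sum>C\<in>set D. (length C)\<^sup>2)"
  proof (rule sum.cong[OF refl])
    fix C assume C: "C \<in> set D"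
    have "card ((!) xs ` set C) = card (set C)"
      using inj sub[OF C] by (intro card_image) (rule inj_on_subset)
    also have "\<dots> = length C" using D(1) C by (simp add: distinct_concat_iff distinct_card)
    finally show "(card ((!) xs ` set C))\<^sup>2 = (length C)\<^sup>2" by simp
  qed
  also have "\<dots> = sq D" using dist by (simp add: sq_def sum_list_distinct_conv_sum_set)
  finally show ?thesis .
qed

text \<open>At the start \<open>i\<close> is the only position outside the class and it is pending,
  so the uniformity condition of \<open>good\<close> is vacuous.\<close>

lemma solve_init:
  fixes A :: "nat \<Rightarrow> nat \<Rightarrow> nat"
  assumes "i < n"
  defines "D \<equiv> solve A [(filter (\<lambda>z. z \<noteq> i) [0..<n], [i])]"
  shows "set (concat D) = {..<n} - {i}" "distinct (concat D)" "[] \<notin> set D"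
    "\<And>C. C \<in> set D \<Longrightarrow> C \<noteq> [] \<and> good n A i C []"
proof -
  let ?C = "filter (\<lambda>z. z \<noteq> i) [0..<n]"
  have C: "set ?C = {..<n} - {i}" by auto
  have "good n A i ?C [i]"
    unfolding good_def C index_module_def using assms(1) by auto
  then have "set (concat D) = set (concat (map fst [(?C, [i])])) \<and> distinct (concat D) \<and>
    (\<forall>C\<in>set D. C \<noteq> [] \<and> good n A i C [])"
    unfolding D_def by (intro solve_good) simp_all
  then show "set (concat D) = {..<n} - {i}" "distinct (concat D)" "[] \<notin> set D"
    "\<And>C. C \<in> set D \<Longrightarrow> C \<noteq> [] \<and> good n A i C []"
    using C by auto
qed

subsection \<open>The machine program\<close>

definition reach :: "program \<Rightarrow> nat \<Rightarrow> config \<Rightarrow> config \<Rightarrow> bool" where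
  "reach p t = step p ^^ t"

lemma reach_0: "reach p 0 c c' \<longleftrightarrow> c = c'"
  by (simp add: reach_def)

text \<open>Peels off the first step rather than the last, as symbolic execution requires.\<close>

lemma reach_Suc:
  "reach p (Suc t) (pc, R, M) c' \<longleftrightarrow> pc < length p \<and> reach p t (exec (p ! pc) (pc, R, M)) c'"
  unfolding reach_def relpowp.simps relpowp_commute[symmetric] by (auto simp: step_def relcompp.simps)

lemma reach_numeral:
  "reach p (numeral k) (pc, R, M) c' \<longleftrightarrow>
     pc < length p \<and> reach p (pred_numeral k) (exec (p ! pc) (pc, R, M)) c'"
  by (simp add: numeral_eq_Suc reach_Suc)

lemma reach_trans: "reach p s a b \<Longrightarrow> reach p t b c \<Longrightarrow> reach p (s + t) a c"
  unfolding reach_def by (auto simp: relpowp_add)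

text \<open>
  All data structures are linked lists of immutable three-cell records, allocated from the free
  address in register 4 upwards; \<open>cell a b c d\<close> stores registers \<open>a\<close>, \<open>b\<close>, \<open>c\<close> in a fresh record
  and its address in register \<open>d\<close>. A member \<open>z\<close> of a list of positions is stored together with
  \<open>z * n\<close>, the start of its matrix row, as the machine cannot multiply.
\<close>

definition cell :: "nat \<Rightarrow> nat \<Rightarrow> nat \<Rightarrow> nat \<Rightarrow> program" where
  "cell a b c d =
     [Store 4 a, Add 16 4 2, Store 16 b, Add 16 16 2, Store 16 c, Add d 4 19, Add 4 16 2]"

text \<open>
  Registers: 2 is the constant 1, 19 the constant 0, 3 the address \<open>n * n\<close> of the labels, 5 the
  worklist, 6 and 7 the current class and its pivots, 8 the row of the current pivot and 9 its entry
  for the first member of the class, 10 and 11 the two new classes, 12 and 13 their pivots, 14 and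
  15 the current position and its row; 16 and 17 are temporary.

  Jump targets: 2 computes \<open>n * n\<close>, 9 builds the initial lists, 40 pops the worklist, 58 divides a
  class, 100 pushes its two parts, 115 labels a final class by its first member.
\<close>

definition prog :: program where
  "prog =
     [Const 2 1, Add 14 0 19,
      JumpZero 14 6, Add 3 3 0, Sub 14 14 2, Jump 2,
      Add 4 3 0, Add 14 0 19, Add 15 3 19,
      JumpZero 14 32, Sub 14 14 2, Sub 15 15 0,
      Sub 16 14 1, Sub 17 1 14, Add 16 16 17, JumpZero 16 24]
     @ cell 14 15 6 6 @ [Jump 9]
     @ cell 14 15 7 7 @ [Jump 9]
     @ cell 6 7 5 5 @ [Add 0 3 19,
      JumpZero 5 124,
      Load 6 5, Add 16 5 2, Load 7 16, Add 16 16 2, Load 5 16, JumpZero 6 40, JumpZero 7 115,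
      Add 16 7 2, Load 8 16, Add 16 16 2, Load 12 16, Add 13 7 19, Const 10 0, Const 11 0,
      Load 16 6, Add 16 16 8, Load 9 16,
      JumpZero 6 100,
      Load 14 6, Add 16 6 2, Load 15 16, Add 16 16 2, Load 6 16,
      Add 16 8 14, Load 16 16, Sub 17 16 9, Sub 16 9 16, Add 16 16 17, JumpZero 16 85]
     @ cell 14 15 11 11 @ cell 14 15 12 12 @ [Jump 58]
     @ cell 14 15 10 10 @ cell 14 15 13 13 @ [Jump 58]
     @ cell 11 13 5 5 @ cell 10 12 5 5 @ [Jump 40,
      Load 9 6,
      JumpZero 6 40, Load 14 6, Add 16 14 3, Store 16 9, Add 16 6 2, Add 16 16 2, Load 6 16,
      Jump 116]"

lemma length_prog: "length prog = 124"
  by (simp add: prog_def cell_def)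

text \<open>Equating \<open>prog\<close> with the list of its own entries gives one equation for
  each \<open>prog ! k\<close>.\<close>

lemmas fetch = trans[OF map_nth[of prog] prog_def, unfolded length_prog cell_def,
  simplified upt_rec[of 0] upt_rec[of "Suc 0"] numeral_2_eq_2[symmetric], simplified]

lemmas exec_code = reach_0 reach_Suc reach_numeral length_prog fetch

section \<open>Memory layout and machine invariants\<close>

text \<open>Address 0 is the null pointer; \<open>z < n\<close> makes the address of every record
  positive. Records lie above the matrix and the labels and below the free address
  \<open>f\<close>.\<close>

fun lst :: "nat \<Rightarrow> (nat \<Rightarrow> nat) \<Rightarrow> nat \<Rightarrow> nat \<Rightarrow> nat list \<Rightarrow> bool" where
  "lst n M f p [] \<longleftrightarrow> p = 0"
| "lst n M f p (z # zs) \<longleftrightarrow>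
     n * n + n \<le> p \<and> p + 3 \<le> f \<and> z < n \<and> M p = z \<and> M (Suc p) = z * n \<and>
     lst n M f (M (Suc (Suc p))) zs"

fun frames :: "nat \<Rightarrow> (nat \<Rightarrow> nat) \<Rightarrow> nat \<Rightarrow> nat \<Rightarrow> (nat list \<times> nat list) list \<Rightarrow> bool" where
  "frames n M f p [] \<longleftrightarrow> p = 0"
| "frames n M f p ((C, L) # W) \<longleftrightarrow>
     0 < p \<and> n * n + n \<le> p \<and> p + 3 \<le> f \<and> lst n M f (M p) C \<and> lst n M f (M (Suc p)) L \<and>
     frames n M f (M (Suc (Suc p))) W"

text \<open>Neither allocation from \<open>f\<close> upwards nor writing labels below
  \<open>n * n + n\<close> touches a record, so lists survive and may share tails.\<close>

lemma lst_mono: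
  "lst n M f p zs \<Longrightarrow> f \<le> f' \<Longrightarrow> (\<And>a. n * n + n \<le> a \<Longrightarrow> a < f \<Longrightarrow> M' a = M a) \<Longrightarrow>
   lst n M' f' p zs"
  by (induction zs arbitrary: p) auto

lemma frames_mono:
  "frames n M f p W \<Longrightarrow> f \<le> f' \<Longrightarrow> (\<And>a. n * n + n \<le> a \<Longrightarrow> a < f \<Longrightarrow> M' a = M a) \<Longrightarrow>
   frames n M' f' p W"
  by (induction n M f p W rule: frames.induct) (auto intro: lst_mono)

text \<open>Register 0 no longer holds \<open>n\<close> but already the output address
  \<open>n * n\<close>.\<close>

definition ctx :: "nat \<Rightarrow> (nat \<Rightarrow> nat \<Rightarrow> nat) \<Rightarrow> (nat \<Rightarrow> nat) \<Rightarrow> (nat \<Rightarrow> nat) \<Rightarrow> bool" where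
  "ctx n A R M \<longleftrightarrow> 0 < n \<and> R 2 = 1 \<and> R 19 = 0 \<and> R 3 = n * n \<and> R 0 = n * n \<and> n * n + n \<le> R 4 \<and>
     (\<forall>y<n. \<forall>z<n. M (y * n + z) = A y z)"

text \<open>\<open>Cs\<close> is the unread part of the class, \<open>C1\<close> and
  \<open>C2\<close> are the halves collected so far, \<open>L1\<close> and \<open>L2\<close> their
  pivot lists.\<close>

definition split_state where
  "split_state n A y W Cs C1 C2 L1 L2 R M \<longleftrightarrow> ctx n A R M \<and> y < n \<and> R 8 = y * n \<and>
     lst n M (R 4) (R 6) Cs \<and> lst n M (R 4) (R 10) C1 \<and> lst n M (R 4) (R 11) C2 \<and>
     lst n M (R 4) (R 12) L1 \<and> lst n M (R 4) (R 13) L2 \<and> frames n M (R 4) (R 5) W"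

lemma matrix_address: "y < n \<Longrightarrow> z < (n::nat) \<Longrightarrow> y * n + z < n * n"
proof -
  assume "y < n" "z < n"
  then have "y * n + z < Suc y * n" by simp
  also have "\<dots> \<le> n * n" using \<open>y < n\<close> by (intro mult_le_mono1) simp
  finally show ?thesis .
qed

section \<open>Execution of the division loop\<close>

text \<open>Each member is pushed onto its half and onto the pivots of the other half. Truncated
  subtraction in both directions tests the entries for equality, and both branches take equally
  long.\<close>

lemma split_loop_step:
  assumes "split_state n A y W (z # Cs) C1 C2 L1 L2 R M"
  shows "\<exists>R' M'. reach prog 27 (58, R, M) (58, R', M') \<and> R' 9 = R 9 \<and>
    (if A y z = R 9 then split_state n A y W Cs (z # C1) C2 L1 (z # L2) R' M'
     else split_state n A y W Cs C1 (z # C2) (z # L1) L2 R' M') \<and>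
    (\<forall>a<n * n + n. M' a = M a)"
proof -
  note s = assms[unfolded split_state_def ctx_def]
  define f where "f = R 4"
  have r [simp]: "M (y * n + z) = A y z" "M (R 6) = z" "M (Suc (R 6)) = z * n" "0 < R 6"
   "R 2 = Suc 0" "R 19 = 0" "R 8 = y * n" "R 4 = f"
    using s by (auto simp: f_def)
  have f: "n * n + n \<le> f"
    using s by simp
  have tl: "lst n M f (M (Suc (Suc (R 6)))) Cs"
    using s by simp
  \<comment> \<open>\<open>p\<close> and \<open>q\<close> are the old heads of the two lists that
    receive \<open>z\<close>.\<close>
  let ?M = "\<lambda>p q. M(f := z, Suc f := z * n, Suc (Suc f) := p,
     Suc (Suc (Suc f)) := z, Suc (Suc (Suc (Suc f))) := z * n, Suc (Suc (Suc (Suc (Suc f)))) := q)"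
  have neq: "\<exists>R'. reach prog 27 (58, R, M) (58, R', ?M (R 11) (R 12)) \<and>
     R' 6 = M (Suc (Suc (R 6))) \<and> R' 10 = R 10 \<and> R' 11 = f \<and> R' 12 = f + 3 \<and> R' 13 = R 13 \<and>
     R' 4 = f + 6 \<and> (\<forall>r\<in>{0,2,3,5,8,9,19}. R' r = R r)" if "A y z \<noteq> R 9"
    using that by (simp add: exec_code)
  have eq: "\<exists>R'. reach prog 27 (58, R, M) (58, R', ?M (R 10) (R 13)) \<and>
     R' 6 = M (Suc (Suc (R 6))) \<and> R' 10 = f \<and> R' 11 = R 11 \<and> R' 12 = R 12 \<and> R' 13 = f + 3 \<and>
     R' 4 = f + 6 \<and> (\<forall>r\<in>{0,2,3,5,8,9,19}. R' r = R r)" if "A y z = R 9"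
    using that by (simp add: exec_code)
  have mono: "lst n (?M p q) (f + 6) l zs" if "lst n M f l zs" for p q l zs
    using that by (rule lst_mono) auto
  have fmono: "frames n (?M p q) (f + 6) l V" if "frames n M f l V" for p q l V
    using that by (rule frames_mono) auto
  have cells: "lst n (?M p q) (f + 6) f (z # zs)" if "lst n M f p zs" for p q zs
    using mono[OF that, of p q] s by simp
  have cells': "lst n (?M p q) (f + 6) (f + 3) (z # zs)" if "lst n M f q zs" for p q zs
    using mono[OF that, of p q] s by (simp add: numeral_3_eq_3)
  have mat: "\<forall>y<n. \<forall>z<n. ?M p q (y * n + z) = A y z" for p q
  proof (intro allI impI)
    fix y z assume yz: "y < n" "z < n"
    then have "y * n + z < f" using matrix_address[OF yz] f by linarith
    then show "?M p q (y * n + z) = A y z" using yz s by simp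
  qed
  show ?thesis
  proof (cases "A y z = R 9")
    case True
    then obtain R' where R': "reach prog 27 (58, R, M) (58, R', ?M (R 10) (R 13))"
     "R' 6 = M (Suc (Suc (R 6)))" "R' 10 = f" "R' 11 = R 11" "R' 12 = R 12" "R' 13 = f + 3"
     "R' 4 = f + 6" "\<forall>r\<in>{0,2,3,5,8,9,19}. R' r = R r"
      using eq by blast
    have "split_state n A y W Cs (z # C1) C2 L1 (z # L2) R' (?M (R 10) (R 13))"
      unfolding split_state_def ctx_def R'(2-7)
      using R'(8) s mat by (auto intro!: mono fmono cells cells' tl trans_le_add1 f
          simp del: lst.simps fun_upd_apply)
    with R' True s show ?thesis by (intro exI[of _ R'] exI[of _ "?M (R 10) (R 13)"]) simp
  next
    case False
    then obtain R' where R': "reach prog 27 (58, R, M) (58, R', ?M (R 11) (R 12))"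
     "R' 6 = M (Suc (Suc (R 6)))" "R' 10 = R 10" "R' 11 = f" "R' 12 = f + 3" "R' 13 = R 13"
     "R' 4 = f + 6" "\<forall>r\<in>{0,2,3,5,8,9,19}. R' r = R r"
      using neq by blast
    have "split_state n A y W Cs C1 (z # C2) (z # L1) L2 R' (?M (R 11) (R 12))"
      unfolding split_state_def ctx_def R'(2-7)
      using R'(8) s mat by (auto intro!: mono fmono cells cells' tl trans_le_add1 f
          simp del: lst.simps fun_upd_apply)
    with R' False s show ?thesis by (intro exI[of _ R'] exI[of _ "?M (R 11) (R 12)"]) simp
  qed
qed

text \<open>The halves and pivot lists act as accumulators, which are arbitrary in the
  induction.\<close>

lemma split_loop:
  assumes "split_state n A y W Cs C1 C2 L1 L2 R M"
  shows "\<exists>R' M'. reach prog (27 * length Cs + 1) (58, R, M) (100, R', M') \<and>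
    split_state n A y W [] (rev (filter (\<lambda>z. A y z = R 9) Cs) @ C1)
      (rev (filter (\<lambda>z. A y z \<noteq> R 9) Cs) @ C2) (rev (filter (\<lambda>z. A y z \<noteq> R 9) Cs) @ L1)
      (rev (filter (\<lambda>z. A y z = R 9) Cs) @ L2) R' M' \<and>
    (\<forall>a<n * n + n. M' a = M a)"
  using assms
proof (induction Cs arbitrary: C1 C2 L1 L2 R M)
  case Nil
  then have "R 6 = 0" by (simp add: split_state_def)
  then have "reach prog 1 (58, R, M) (100, R, M)" by (simp add: exec_code)
  with Nil show ?case by auto
next
  case (Cons z Cs)
  from split_loop_step[OF Cons.prems] obtain R1 M1 where
    1: "reach prog 27 (58, R, M) (58, R1, M1)" "R1 9 = R 9"
      "if A y z = R 9 then split_state n A y W Cs (z # C1) C2 L1 (z # L2) R1 M1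
       else split_state n A y W Cs C1 (z # C2) (z # L1) L2 R1 M1"
      "\<forall>a<n * n + n. M1 a = M a"
    by blast
  have len: "27 * length (z # Cs) + 1 = 27 + (27 * length Cs + 1)" by simp
  show ?case
  proof (cases "A y z = R 9")
    case True
    with 1(3) have "split_state n A y W Cs (z # C1) C2 L1 (z # L2) R1 M1" by simp
    from Cons.IH[OF this, unfolded 1(2)] obtain R' M' where
      2: "reach prog (27 * length Cs + 1) (58, R1, M1) (100, R', M')"
        "split_state n A y W [] (rev (filter (\<lambda>z. A y z = R 9) Cs) @ z # C1)
          (rev (filter (\<lambda>z. A y z \<noteq> R 9) Cs) @ C2) (rev (filter (\<lambda>z. A y z \<noteq> R 9) Cs) @ L1)
          (rev (filter (\<lambda>z. A y z = R 9) Cs) @ z # L2) R' M'"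
        "\<forall>a<n * n + n. M' a = M1 a"
      by blast
    show ?thesis unfolding len using reach_trans[OF 1(1) 2(1)] 2(2,3) True 1(4)
      by (intro exI[of _ R'] exI[of _ M']) simp
  next
    case False
    with 1(3) have "split_state n A y W Cs C1 (z # C2) (z # L1) L2 R1 M1" by simp
    from Cons.IH[OF this, unfolded 1(2)] obtain R' M' where
      2: "reach prog (27 * length Cs + 1) (58, R1, M1) (100, R', M')"
        "split_state n A y W [] (rev (filter (\<lambda>z. A y z = R 9) Cs) @ C1)
          (rev (filter (\<lambda>z. A y z \<noteq> R 9) Cs) @ z # C2)
          (rev (filter (\<lambda>z. A y z \<noteq> R 9) Cs) @ z # L1)
          (rev (filter (\<lambda>z. A y z = R 9) Cs) @ L2) R' M'"
        "\<forall>a<n * n + n. M' a = M1 a"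
      by blast
    show ?thesis unfolding len using reach_trans[OF 1(1) 2(1)] 2(2,3) False 1(4)
      by (intro exI[of _ R'] exI[of _ M']) simp
  qed
qed

text \<open>\<open>C2\<close> is pushed first, so that \<open>C1\<close> ends up in front as in
  \<open>solve\<close>.\<close>

lemma push_classes:
  assumes "split_state n A y W [] C1 C2 L1 L2 R M"
  shows "\<exists>R' M'. reach prog 15 (100, R, M) (40, R', M') \<and> ctx n A R' M' \<and>
    frames n M' (R' 4) (R' 5) ((C1, L1) # (C2, L2) # W) \<and> (\<forall>a<n * n + n. M' a = M a)"
proof -
  note s = assms[unfolded split_state_def ctx_def]
  define f where "f = R 4"
  have r [simp]: "R 2 = Suc 0" "R 19 = 0" "R 4 = f"
    using s by (auto simp: f_def)
  have f: "n * n + n \<le> f"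
    using s by simp
  let ?M = "M(f := R 11, Suc f := R 13, Suc (Suc f) := R 5,
     Suc (Suc (Suc f)) := R 10, Suc (Suc (Suc (Suc f))) := R 12,
     Suc (Suc (Suc (Suc (Suc f)))) := f)"
  have "\<exists>R'. reach prog 15 (100, R, M) (40, R', ?M) \<and>
     R' 4 = f + 6 \<and> R' 5 = f + 3 \<and> (\<forall>r\<in>{0,2,3,19}. R' r = R r)"
    by (simp add: exec_code)
  then obtain R' where R': "reach prog 15 (100, R, M) (40, R', ?M)"
     "R' 4 = f + 6" "R' 5 = f + 3" "\<forall>r\<in>{0,2,3,19}. R' r = R r"
    by blast
  have mono: "lst n ?M (f + 6) l zs" if "lst n M f l zs" for l zs
    using that by (rule lst_mono) auto
  have fmono: "frames n ?M (f + 6) l V" if "frames n M f l V" for l V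
    using that by (rule frames_mono) auto
  have mat: "\<forall>y<n. \<forall>z<n. ?M (y * n + z) = A y z"
  proof (intro allI impI)
    fix y z assume yz: "y < n" "z < n"
    then have "y * n + z < f" using matrix_address[OF yz] f by linarith
    then show "?M (y * n + z) = A y z" using yz s by simp
  qed
  have "lst n ?M (f + 6) (R 10) C1" "lst n ?M (f + 6) (R 12) L1" "lst n ?M (f + 6) (R 11) C2"
    "lst n ?M (f + 6) (R 13) L2" "frames n ?M (f + 6) (R 5) W"
    by (rule mono fmono, use s in simp)+
  then have "frames n ?M (f + 6) (f + 3) ((C1, L1) # (C2, L2) # W)"
    using f s by (simp add: numeral_3_eq_3)
  moreover have "ctx n A R' ?M"
    unfolding ctx_def R'(2) using R'(4) s f mat by (simp del: fun_upd_apply)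
  ultimately have "ctx n A R' ?M \<and> frames n ?M (R' 4) (R' 5) ((C1, L1) # (C2, L2) # W)"
    unfolding R'(2,3) by simp
  with R' s show ?thesis by (intro exI[of _ R'] exI[of _ ?M]) simp
qed

section \<open>Processing the worklist\<close>

lemma pop_empty:
  assumes "ctx n A R M" "frames n M (R 4) (R 5) (([], L) # W)"
  shows "\<exists>R'. reach prog 7 (40, R, M) (40, R', M) \<and> ctx n A R' M \<and> frames n M (R' 4) (R' 5) W"
  using assms by (simp add: exec_code ctx_def)

lemma pop_done:
  assumes "ctx n A R M" "frames n M (R 4) (R 5) ((c # C, []) # W)"
  shows "\<exists>R'. reach prog 9 (40, R, M) (116, R', M) \<and> ctx n A R' M \<and> R' 9 = c \<and>
    lst n M (R' 4) (R' 6) (c # C) \<and> frames n M (R' 4) (R' 5) W"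
  using assms by (simp add: exec_code ctx_def)

text \<open>The pivot lists start as \<open>L\<close> and \<open>y # L\<close>, two pointers into
  the same records, so the cost is independent of their length.\<close>

lemma pop_split:
  assumes "ctx n A R M" "frames n M (R 4) (R 5) ((c # C, y # L) # W)"
  shows "\<exists>R'. reach prog 18 (40, R, M) (58, R', M) \<and> R' 9 = A y c \<and>
    split_state n A y W (c # C) [] [] L (y # L) R' M"
  using assms by (simp add: exec_code ctx_def split_state_def add.commute)

text \<open>The labels occupy the \<open>n\<close> addresses between the matrix and the records, so
  writing them disturbs neither.\<close>

lemma output_loop:
  assumes "ctx n A R M" "lst n M (R 4) (R 6) C" "frames n M (R 4) (R 5) W"
  shows "\<exists>R' M'. reach prog (8 * length C + 1) (116, R, M) (40, R', M') \<and> ctx n A R' M' \<and>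
    frames n M' (R' 4) (R' 5) W \<and>
    (\<forall>z<n. M' (n * n + z) = (if z \<in> set C then R 9 else M (n * n + z)))"
  using assms
proof (induction C arbitrary: R M)
  case Nil
  then have "R 6 = 0" by simp
  then have "reach prog 1 (116, R, M) (40, R, M)" by (simp add: exec_code)
  with Nil show ?case by auto
next
  case (Cons c C)
  note s = Cons.prems[unfolded ctx_def]
  let ?M = "M(n * n + c := R 9)"
  have c: "c < n" using s by simp
  have r: "R 2 = Suc 0" "R 3 = n * n" "M (R 6) = c" "0 < R 6" "R 6 \<noteq> n * n + c"
    "Suc (R 6) \<noteq> n * n + c" "Suc (Suc (R 6)) \<noteq> n * n + c"
    using s by auto
  have "\<exists>R'. reach prog 8 (116, R, M) (116, R', ?M) \<and> R' 6 = M (Suc (Suc (R 6))) \<and>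
     (\<forall>r\<in>{0,2,3,4,5,9,19}. R' r = R r)"
    using r by (simp add: exec_code add.commute)
  then obtain R1 where R1: "reach prog 8 (116, R, M) (116, R1, ?M)" "R1 6 = M (Suc (Suc (R 6)))"
     "\<forall>r\<in>{0,2,3,4,5,9,19}. R1 r = R r"
    by blast
  have mono: "lst n ?M (R 4) l zs" if "lst n M (R 4) l zs" for l zs
    using that by (rule lst_mono) (use c in auto)
  have fmono: "frames n ?M (R 4) l V" if "frames n M (R 4) l V" for l V
    using that by (rule frames_mono) (use c in auto)
  have mat: "\<forall>y<n. \<forall>z<n. ?M (y * n + z) = A y z"
  proof (intro allI impI)
    fix y z assume yz: "y < n" "z < n"
    then have "y * n + z < n * n + c" using matrix_address[OF yz] by simp
    then show "?M (y * n + z) = A y z" using yz s by simp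
  qed
  have "ctx n A R1 ?M" "lst n ?M (R1 4) (R1 6) C" "frames n ?M (R1 4) (R1 5) W"
    unfolding ctx_def using R1(2-) s mono fmono mat by simp_all
  from Cons.IH[OF this] obtain R' M' where
    2: "reach prog (8 * length C + 1) (116, R1, ?M) (40, R', M')" "ctx n A R' M'"
       "frames n M' (R' 4) (R' 5) W"
       "\<forall>z<n. M' (n * n + z) = (if z \<in> set C then R1 9 else ?M (n * n + z))"
    by blast
  have len: "8 * length (c # C) + 1 = 8 + (8 * length C + 1)" by simp
  show ?case unfolding len using reach_trans[OF R1(1) 2(1)] 2(2-4) R1(3)
    by (intro exI[of _ R'] exI[of _ M']) auto
qed

text \<open>Each round lowers \<open>lower\<close> by at most, and \<open>upper\<close> by at least,
  the time it takes, where the squares of finished classes move into \<open>sq\<close>. The final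
  test for an empty worklist accounts for the \<open>+ 1\<close>.\<close>

lemma run_solve:
  assumes "ctx n A R M" "frames n M (R 4) (R 5) W"
  shows "\<exists>t R' M'. reach prog t (40, R, M) (124, R', M') \<and> R' 0 = n * n \<and>
    (\<forall>z<n. M' (n * n + z) = relabel (\<lambda>z. M (n * n + z)) (solve A W) z) \<and>
    lower W \<le> t + sq (solve A W) \<and> t + 82 * sq (solve A W) \<le> upper W + 1"
  using assms
proof (induction A W arbitrary: R M rule: solve.induct)
  case (1 A)
  then have "reach prog 1 (40, R, M) (124, R, M)" by (simp add: exec_code)
  with 1 show ?case
    by (intro exI[of _ 1] exI[of _ R] exI[of _ M])
      (simp add: ctx_def relabel_def sq_def lower_def upper_def)
next
  case (2 A L W)
  from pop_empty[OF 2(2,3)] obtain R1 where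
    R1: "reach prog 7 (40, R, M) (40, R1, M)" "ctx n A R1 M" "frames n M (R1 4) (R1 5) W"
    by blast
  from 2(1)[OF R1(2,3)] obtain t R' M' where
    *: "reach prog t (40, R1, M) (124, R', M')" "R' 0 = n * n"
      "\<forall>z<n. M' (n * n + z) = relabel (\<lambda>z. M (n * n + z)) (solve A W) z"
      "lower W \<le> t + sq (solve A W)" "t + 82 * sq (solve A W) \<le> upper W + 1"
    by blast
  show ?case using reach_trans[OF R1(1) *(1)] *(2-)
    by (intro exI[of _ "7 + t"] exI[of _ R'] exI[of _ M']) (simp add: lower_def upper_def)
next
  case (3 A c C W)
  from pop_done[OF 3(2,3)] obtain R1 where
    R1: "reach prog 9 (40, R, M) (116, R1, M)" "ctx n A R1 M" "R1 9 = c"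
      "lst n M (R1 4) (R1 6) (c # C)" "frames n M (R1 4) (R1 5) W"
    by blast
  from output_loop[OF R1(2,4,5)] obtain R2 M2 where
    R2: "reach prog (8 * length (c # C) + 1) (116, R1, M) (40, R2, M2)" "ctx n A R2 M2"
      "frames n M2 (R2 4) (R2 5) W"
      "\<forall>z<n. M2 (n * n + z) = (if z \<in> set (c # C) then R1 9 else M (n * n + z))"
    by blast
  from 3(1)[OF R2(2,3)] obtain t R' M' where
    *: "reach prog t (40, R2, M2) (124, R', M')" "R' 0 = n * n"
      "\<forall>z<n. M' (n * n + z) = relabel (\<lambda>z. M2 (n * n + z)) (solve A W) z"
      "lower W \<le> t + sq (solve A W)" "t + 82 * sq (solve A W) \<le> upper W + 1"
    by blast
  have "M' (n * n + z) = relabel (\<lambda>z. M (n * n + z)) (solve A ((c # C, []) # W)) z" if "z < n" for z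
    using *(3) R2(4) R1(3) that
    by (auto simp: relabel_Cons intro!: relabel_cong)
  moreover have "reach prog (9 + (8 * length (c # C) + 1 + t)) (40, R, M) (124, R', M')"
    by (intro reach_trans[OF R1(1)] reach_trans[OF R2(1)] *(1))
  \<comment> \<open>The class is nonempty, so \<open>11 * |C| + 7\<close> covers the
    \<open>8 * |C| + 10\<close> instructions.\<close>
  ultimately show ?case using *(2,4,5)
    by (intro exI[of _ "9 + (8 * length (c # C) + 1 + t)"] exI[of _ R'] exI[of _ M'])
      (simp add: lower_def upper_def sq_def)
next
  case (4 A c C y L W)
  define C1 where "C1 = rev (filter (\<lambda>z. A y z = A y c) (c # C))"
  define C2 where "C2 = rev (filter (\<lambda>z. A y z \<noteq> A y c) (c # C))"
  let ?W = "(C1, C2 @ L) # (C2, C1 @ y # L) # W"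
  have len: "length (c # C) = length C1 + length C2"
    unfolding C1_def C2_def length_rev by (rule length_filter_split)
  have ne: "C1 \<noteq> []" by (simp add: C1_def)
  have solve: "solve A ((c # C, y # L) # W) = solve A ?W"
    by (simp only: solve.simps Let_def C1_def C2_def)
  from pop_split[OF 4(2,3)] obtain R1 where
    R1: "reach prog 18 (40, R, M) (58, R1, M)" "R1 9 = A y c"
      "split_state n A y W (c # C) [] [] L (y # L) R1 M"
    by blast
  from split_loop[OF R1(3)] obtain R2 M2 where
    R2: "reach prog (27 * length (c # C) + 1) (58, R1, M) (100, R2, M2)"
      "split_state n A y W [] C1 C2 (C2 @ L) (C1 @ y # L) R2 M2" "\<forall>a<n * n + n. M2 a = M a"
    unfolding R1(2) C1_def[symmetric] C2_def[symmetric] append_Nil2 by blast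
  from push_classes[OF R2(2)] obtain R3 M3 where
    R3: "reach prog 15 (100, R2, M2) (40, R3, M3)" "ctx n A R3 M3"
      "frames n M3 (R3 4) (R3 5) ?W" "\<forall>a<n * n + n. M3 a = M2 a"
    by blast
  from 4(1)[OF C1_def C2_def R3(2,3)] obtain t R' M' where
    *: "reach prog t (40, R3, M3) (124, R', M')" "R' 0 = n * n"
      "\<forall>z<n. M' (n * n + z) = relabel (\<lambda>z. M3 (n * n + z)) (solve A ?W) z"
      "lower ?W \<le> t + sq (solve A ?W)" "t + 82 * sq (solve A ?W) \<le> upper ?W + 1"
    by blast
  have "M' (n * n + z) = relabel (\<lambda>z. M (n * n + z)) (solve A ?W) z" if "z < n" for z
    using *(3) R3(4) R2(3) that by (auto intro!: relabel_cong)
  moreover have "reach prog (18 + (27 * length (c # C) + 1 + (15 + t))) (40, R, M) (124, R', M')"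
    by (intro reach_trans[OF R1(1)] reach_trans[OF R2(1)] reach_trans[OF R3(1)] *(1))
  ultimately show ?case
    unfolding solve using *(2,4,5) lower_split[OF len, of y L W] upper_split[OF len ne, of L y W] len
    by (intro exI[of _ "18 + (27 * length (c # C) + 1 + (15 + t))"] exI[of _ R'] exI[of _ M']
        conjI) (assumption | simp)+
qed

section \<open>Initialisation and total running time\<close>

lemma square_loop:
  assumes "R 14 = k" "R 2 = 1"
  shows "\<exists>R'. reach prog (4 * k + 1) (2, R, M) (6, R', M) \<and> R' 3 = R 3 + k * R 0 \<and>
    (\<forall>r. r \<notin> {3, 14} \<longrightarrow> R' r = R r)"
  using assms
proof (induction k arbitrary: R)
  case 0
  then have "reach prog 1 (2, R, M) (6, R, M)" by (simp add: exec_code)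
  then show ?case by auto
next
  case (Suc k)
  let ?R = "R(3 := R 3 + R 0, 14 := k)"
  have 1: "reach prog 4 (2, R, M) (2, ?R, M)"
    using Suc.prems by (simp add: exec_code)
  have "?R 14 = k" "?R 2 = 1"
    using Suc.prems by simp_all
  from Suc.IH[OF this] obtain R' where
    2: "reach prog (4 * k + 1) (2, ?R, M) (6, R', M)" "R' 3 = ?R 3 + k * ?R 0"
    "\<forall>r. r \<notin> {3, 14} \<longrightarrow> R' r = ?R r"
    by blast
  have len: "4 * Suc k + 1 = 4 + (4 * k + 1)" by simp
  show ?case unfolding len using reach_trans[OF 1 2(1)] 2(2,3)
    by (intro exI[of _ R']) (simp add: algebra_simps)
qed

lemma lst_cell:
  assumes "lst n M f p zs" "n * n + n \<le> f" "z < n"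
  shows "lst n (M(f := z, Suc f := z * n, Suc (Suc f) := p)) (f + 3) f (z # zs)"
proof -
  have "lst n (M(f := z, Suc f := z * n, Suc (Suc f) := p)) (f + 3) p zs"
    using assms(1) by (rule lst_mono) auto
  with assms(2,3) show ?thesis by simp
qed

text \<open>Positions are visited downwards, since pushing onto the front then yields increasing
  lists. Each row address arises from the previous one by subtracting \<open>n\<close>.\<close>

lemma list_loop:
  assumes "R 14 = k" "R 15 = k * n" "k \<le> n" "R 0 = n" "R 1 = i" "R 2 = 1" "R 19 = 0"
    "n * n + n \<le> R 4" "lst n M (R 4) (R 6) (filter (\<lambda>z. z \<noteq> i) [k..<n])"
    "lst n M (R 4) (R 7) (filter (\<lambda>z. z = i) [k..<n])"
  shows "\<exists>R' M'. reach prog (15 * k + 1) (9, R, M) (32, R', M') \<and> n * n + n \<le> R' 4 \<and>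
    lst n M' (R' 4) (R' 6) (filter (\<lambda>z. z \<noteq> i) [0..<n]) \<and>
    lst n M' (R' 4) (R' 7) (filter (\<lambda>z. z = i) [0..<n]) \<and>
    (\<forall>r\<in>{2,3,5,19}. R' r = R r) \<and> (\<forall>a<n * n + n. M' a = M a)"
  using assms
proof (induction k arbitrary: R M)
  case 0
  then have "reach prog 1 (9, R, M) (32, R, M)" by (simp add: exec_code)
  with 0 show ?case by auto
next
  case (Suc k)
  note s = Suc.prems
  define f where "f = R 4"
  have k: "k < n" and f: "n * n + n \<le> f" using s by (auto simp: f_def)
  have upt: "[k..<n] = k # [Suc k..<n]" using k by (rule upt_conv_Cons)
  let ?M = "\<lambda>p. M(f := k, Suc f := k * n, Suc (Suc f) := p)"
  have len: "15 * Suc k + 1 = 15 + (15 * k + 1)" by simp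
  have mono: "lst n (?M p) (f + 3) l zs" if "lst n M f l zs" for p l zs
    using that by (rule lst_mono) auto
  have "\<exists>R1 M1. reach prog 15 (9, R, M) (9, R1, M1) \<and> R1 14 = k \<and> R1 15 = k * n \<and>
    n * n + n \<le> R1 4 \<and> lst n M1 (R1 4) (R1 6) (filter (\<lambda>z. z \<noteq> i) [k..<n]) \<and>
    lst n M1 (R1 4) (R1 7) (filter (\<lambda>z. z = i) [k..<n]) \<and>
    (\<forall>r\<in>{0,1,2,3,5,19}. R1 r = R r) \<and> (\<forall>a<n * n + n. M1 a = M a)"
  proof (cases "k = i")
    case True
    have "\<exists>R1. reach prog 15 (9, R, M) (9, R1, ?M (R 7)) \<and> R1 14 = k \<and> R1 15 = k * n \<and>
      R1 4 = f + 3 \<and> R1 6 = R 6 \<and> R1 7 = f \<and> (\<forall>r\<in>{0,1,2,3,5,19}. R1 r = R r)"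
      using s(1,2,4-7) True by (simp add: exec_code f_def)
    then obtain R1 where R1: "reach prog 15 (9, R, M) (9, R1, ?M (R 7))" "R1 14 = k"
      "R1 15 = k * n" "R1 4 = f + 3" "R1 6 = R 6" "R1 7 = f"
      "\<forall>r\<in>{0,1,2,3,5,19}. R1 r = R r"
      by blast
    have "lst n (?M (R 7)) (f + 3) f (filter (\<lambda>z. z = i) [k..<n])"
      using lst_cell[OF s(10)[folded f_def] f k] True upt by simp
    moreover have "lst n (?M (R 7)) (f + 3) (R 6) (filter (\<lambda>z. z \<noteq> i) [k..<n])"
      using mono[OF s(9)[folded f_def]] True upt by simp
    ultimately show ?thesis using R1 f by (intro exI[of _ R1] exI[of _ "?M (R 7)"]) simp
  next
    case False
    have "\<exists>R1. reach prog 15 (9, R, M) (9, R1, ?M (R 6)) \<and> R1 14 = k \<and> R1 15 = k * n \<and>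
      R1 4 = f + 3 \<and> R1 6 = f \<and> R1 7 = R 7 \<and> (\<forall>r\<in>{0,1,2,3,5,19}. R1 r = R r)"
      using s(1,2,4-7) False by (auto simp: exec_code f_def)
    then obtain R1 where R1: "reach prog 15 (9, R, M) (9, R1, ?M (R 6))" "R1 14 = k"
      "R1 15 = k * n" "R1 4 = f + 3" "R1 6 = f" "R1 7 = R 7"
      "\<forall>r\<in>{0,1,2,3,5,19}. R1 r = R r"
      by blast
    have "lst n (?M (R 6)) (f + 3) f (filter (\<lambda>z. z \<noteq> i) [k..<n])"
      using lst_cell[OF s(9)[folded f_def] f k] False upt by simp
    moreover have "lst n (?M (R 6)) (f + 3) (R 7) (filter (\<lambda>z. z = i) [k..<n])"
      using mono[OF s(10)[folded f_def]] False upt by simp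
    ultimately show ?thesis using R1 f by (intro exI[of _ R1] exI[of _ "?M (R 6)"]) simp
  qed
  then obtain R1 M1 where 1: "reach prog 15 (9, R, M) (9, R1, M1)" "R1 14 = k" "R1 15 = k * n"
    "n * n + n \<le> R1 4" "lst n M1 (R1 4) (R1 6) (filter (\<lambda>z. z \<noteq> i) [k..<n])"
    "lst n M1 (R1 4) (R1 7) (filter (\<lambda>z. z = i) [k..<n])"
    "\<forall>r\<in>{0,1,2,3,5,19}. R1 r = R r" "\<forall>a<n * n + n. M1 a = M a"
    by blast
  have "R1 0 = n" "R1 1 = i" "R1 2 = 1" "R1 19 = 0" using 1(7) s by simp_all
  from Suc.IH[OF 1(2,3) less_imp_le[OF k] this 1(4-6)] obtain R' M' where
    2: "reach prog (15 * k + 1) (9, R1, M1) (32, R', M')" "n * n + n \<le> R' 4"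
    "lst n M' (R' 4) (R' 6) (filter (\<lambda>z. z \<noteq> i) [0..<n])"
    "lst n M' (R' 4) (R' 7) (filter (\<lambda>z. z = i) [0..<n])"
    "\<forall>r\<in>{2,3,5,19}. R' r = R1 r" "\<forall>a<n * n + n. M' a = M1 a"
    by blast
  show ?case unfolding len using reach_trans[OF 1(1) 2(1)] 2(2-6) 1(7,8)
    by (intro exI[of _ R'] exI[of _ M']) simp
qed

lemma filter_eq_upt: "i < n \<Longrightarrow> filter (\<lambda>z. z = i) [0..<n] = [i]"
  by (induction n) (auto simp: less_Suc_eq filter_empty_conv)

lemma run_init:
  assumes "i < n"
  shows "\<exists>t R M. reach prog t (0, input_regs n i, input_mem n A) (40, R, M) \<and> t = 19 * n + 15 \<and>
    ctx n A R M \<and> frames n M (R 4) (R 5) [(filter (\<lambda>z. z \<noteq> i) [0..<n], [i])]"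
proof -
  let ?M = "input_mem n A"
  let ?R = "(input_regs n i)(2 := 1, 14 := n)"
  have 1: "reach prog 2 (0, input_regs n i, ?M) (2, ?R, ?M)"
    by (simp add: exec_code input_regs_def)
  have "?R 14 = n" "?R 2 = 1" by simp_all
  from square_loop[OF this] obtain R1 where "reach prog (4 * n + 1) (2, ?R, ?M) (6, R1, ?M)"
    "R1 3 = ?R 3 + n * ?R 0" "\<forall>r. r \<notin> {3, 14} \<longrightarrow> R1 r = ?R r"
    by blast
  then have R1: "reach prog (4 * n + 1) (2, ?R, ?M) (6, R1, ?M)"
    "R1 3 = n * n" "R1 0 = n" "R1 1 = i" "R1 2 = 1" "R1 5 = 0" "R1 6 = 0" "R1 7 = 0" "R1 19 = 0"
    by (simp_all add: input_regs_def)
  let ?R2 = "R1(4 := n * n + n, 14 := n, 15 := n * n)"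
  have 2: "reach prog 3 (6, R1, ?M) (9, ?R2, ?M)"
    using R1(2-) by (simp add: exec_code)
  have "\<exists>R' M'. reach prog (15 * n + 1) (9, ?R2, ?M) (32, R', M') \<and> n * n + n \<le> R' 4 \<and>
    lst n M' (R' 4) (R' 6) (filter (\<lambda>z. z \<noteq> i) [0..<n]) \<and>
    lst n M' (R' 4) (R' 7) (filter (\<lambda>z. z = i) [0..<n]) \<and>
    (\<forall>r\<in>{2,3,5,19}. R' r = ?R2 r) \<and> (\<forall>a<n * n + n. M' a = ?M a)"
    by (rule list_loop) (use R1 in simp_all)
  then obtain R3 M3 where R3: "reach prog (15 * n + 1) (9, ?R2, ?M) (32, R3, M3)"
    "n * n + n \<le> R3 4" "lst n M3 (R3 4) (R3 6) (filter (\<lambda>z. z \<noteq> i) [0..<n])"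
    "lst n M3 (R3 4) (R3 7) [i]"
    "\<forall>r\<in>{2,3,5,19}. R3 r = ?R2 r" "\<forall>a<n * n + n. M3 a = ?M a"
    unfolding filter_eq_upt[OF assms] by blast
  define f where "f = R3 4"
  \<comment> \<open>The last cell receives register 5, which is still 0 and ends the
    worklist.\<close>
  let ?M4 = "M3(f := R3 6, Suc f := R3 7, Suc (Suc f) := 0)"
  have "\<exists>R4. reach prog 8 (32, R3, M3) (40, R4, ?M4) \<and> R4 4 = f + 3 \<and> R4 5 = f \<and> R4 0 = n * n \<and>
      R4 2 = 1 \<and> R4 3 = n * n \<and> R4 19 = 0"
    using R3(5) R1 by (simp add: exec_code f_def)
  then obtain R4 where R4: "reach prog 8 (32, R3, M3) (40, R4, ?M4)" "R4 4 = f + 3" "R4 5 = f"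
     "R4 0 = n * n" "R4 2 = 1" "R4 3 = n * n" "R4 19 = 0"
    by blast
  have mono: "lst n ?M4 (f + 3) l zs" if "lst n M3 f l zs" for l zs
    using that by (rule lst_mono) auto
  have f: "n * n + n \<le> f" using R3(2) by (simp add: f_def)
  have "?M4 (y * n + z) = A y z" if "y < n" "z < n" for y z
    using matrix_address[OF that] f R3(6) that by (simp add: input_mem_def)
  then have "ctx n A R4 ?M4" using R4(2-) f assms by (simp add: ctx_def)
  moreover have "frames n ?M4 (R4 4) (R4 5) [(filter (\<lambda>z. z \<noteq> i) [0..<n], [i])]"
    using mono[OF R3(3)[folded f_def]] mono[OF R3(4)[folded f_def]] f R4 assms by auto
  moreover have "reach prog (2 + (4 * n + 1 + (3 + (15 * n + 1 + 8))))
      (0, input_regs n i, ?M) (40, R4, ?M4)"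
    by (intro reach_trans[OF 1] reach_trans[OF R1(1)] reach_trans[OF 2] reach_trans[OF R3(1)] R4(1))
  ultimately show ?thesis
    by (intro exI[of _ "2 + (4 * n + 1 + (3 + (15 * n + 1 + 8)))"] exI[of _ R4] exI[of _ ?M4])
     (simp del: fun_upd_apply)
qed

lemma halts_in_reach: "reach p t (0, R, M) (length p, R', M') \<Longrightarrow> halts_in p R M t R' M'"
  by (auto simp: halts_in_def reach_def)

lemma run_prog:
  fixes A :: "nat \<Rightarrow> nat \<Rightarrow> nat"
  assumes "i < n"
  defines "D \<equiv> solve A [(filter (\<lambda>z. z \<noteq> i) [0..<n], [i])]"
  shows "\<exists>t R M f. halts_in prog (input_regs n i) (input_mem n A) t R M \<and>
    (\<forall>z<n. M (R 0 + z) = relabel f D z) \<and>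
    (n - 1) + (n - 1)\<^sup>2 \<le> t + sq D \<and> t + 82 * sq D \<le> 82 * (n - 1)\<^sup>2 + 121 * n"
proof -
  let ?W = "[(filter (\<lambda>z. z \<noteq> i) [0..<n], [i])]"
  from run_init[OF assms(1)] obtain s R M where
    1: "reach prog s (0, input_regs n i, input_mem n A) (40, R, M)" "s = 19 * n + 15"
      "ctx n A R M" "frames n M (R 4) (R 5) ?W"
    by blast
  from run_solve[OF 1(3,4)] obtain t R' M' where
    2: "reach prog t (40, R, M) (length prog, R', M')" "R' 0 = n * n"
    "\<forall>z<n. M' (n * n + z) = relabel (\<lambda>z. M (n * n + z)) D z"
    "lower ?W \<le> t + sq D" "t + 82 * sq D \<le> upper ?W + 1"
    unfolding D_def length_prog by blast
  have "length (filter (\<lambda>z. z \<noteq> i) [0..<n]) = n - 1"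
    using length_filter_split[of "[0..<n]" "\<lambda>z. z = i"] filter_eq_upt[OF assms(1)] by simp
  then have "lower ?W = (n - 1) + (n - 1)\<^sup>2" "upper ?W = 79 * (n - 1) + 82 * (n - 1)\<^sup>2 + 7"
    by (simp_all add: lower_def upper_def)
  \<comment> \<open>Initialisation takes \<open>19 * n + 15\<close>; together with
    \<open>79 * (n - 1) + 8\<close> this is \<open>98 * n - 56\<close>, below
    \<open>121 * n\<close>.\<close>
  with 2(4,5) have "(n - 1) + (n - 1)\<^sup>2 \<le> s + t + sq D"
    "s + t + 82 * sq D \<le> 82 * (n - 1)\<^sup>2 + 121 * n"
    using 1(2) assms(1) by linarith+
  moreover have "halts_in prog (input_regs n i) (input_mem n A) (s + t) R' M'"
    using reach_trans[OF 1(1) 2(1)] by (rule halts_in_reach)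
  ultimately show ?thesis using 2(2,3)
    by (intro exI[of _ "s + t"] exI[of _ R'] exI[of _ M'] exI[of _ "\<lambda>z. M (n * n + z)"]) simp
qed

subsection \<open>The running time\<close>

theorem theorem6:
  shows "\<exists>(p :: program) (c\<^sub>1 :: real) (c\<^sub>2 :: real). 0 < c\<^sub>1 \<and> 0 < c\<^sub>2 \<and>
    (\<forall>(X :: 'a set) H x xs A i.
       finite X \<longrightarrow> homogeneous_relation X H \<longrightarrow> x \<in> X \<longrightarrow>
       matrix_representation X H xs A \<longrightarrow> i < length xs \<longrightarrow> xs ! i = x \<longrightarrow>
       (\<exists>t R M.
          halts_in p (input_regs (card X) i) (input_mem (card X) A) t R M \<and>
          output_partition xs i R M = MaxM X H x \<and>
          c\<^sub>1 * real (Q (MaxM X H x)) \<le> real t \<and>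
          (Q (MaxM X H x) \<noteq> 0 \<longrightarrow> real t \<le> c\<^sub>2 * real (Q (MaxM X H x))) \<and>
          (Q (MaxM X H x) = 0 \<longrightarrow> real t \<le> c\<^sub>2 * real (card X)) \<and>
          real (Q (MaxM X H x)) \<le> c\<^sub>2 * (real (card X))\<^sup>2 \<and>
          real t \<le> c\<^sub>2 * (real (card X))\<^sup>2))"
proof (rule exI[of _ prog], rule exI[of _ 1], rule exI[of _ 527], intro conjI allI impI)
  fix X :: "'a set" and H x xs A i
  assume X: "finite X" and H: "homogeneous_relation X H" and x: "x \<in> X"
    and rep: "matrix_representation X H xs A" and i: "i < length xs" and xi: "xs ! i = x"
  let ?P = "MaxM X H x"
  define n where "n = card X"
  define D where "D = solve A [(filter (\<lambda>z. z \<noteq> i) [0..<n], [i])]"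
  have xs: "distinct xs" "set xs = X" using rep by (auto simp: matrix_representation_def)
  have n: "n = length xs" using xs distinct_card[OF xs(1)] by (simp add: n_def)
  note D = solve_init[OF i[folded n], where A = A, folded D_def]
  have P: "?P = (\<lambda>C. (!) xs ` set C) ` set D"
    using MaxM_eq_classes[OF H rep i D(1,4)[unfolded n]] xi by simp
  obtain t R M f where run: "halts_in prog (input_regs n i) (input_mem n A) t R M"
    "\<forall>z<n. M (R 0 + z) = relabel f D z"
    and t: "(n - 1) + (n - 1)\<^sup>2 \<le> t + sq D" "t + 82 * sq D \<le> 82 * (n - 1)\<^sup>2 + 121 * n"
    using run_prog[OF i[folded n], where A = A] unfolding D_def[symmetric] by blast
  have out: "output_partition xs i R M = ?P"
    unfolding P using D(1)[unfolded n] D(2,3) run(2)[unfolded n] by (rule output_partition_eq_classes)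
  have m: "card (X - {x}) = n - 1" using X x by (simp add: n_def)
  have part: "partition_on (X - {x}) ?P" using X H x by (rule MaxM_partition)
  have "set (concat D) \<subseteq> {..<length xs}" using D(1) n by auto
  from sq_eq_sum_card[OF D(2,3) this xs(1)]
  have sq: "2 * Q ?P + sq D = (n - 1)\<^sup>2"
    using Q_sum_squares[OF _ part] X m unfolding P by simp
  \<comment> \<open>By \<open>sq\<close>, the difference \<open>(n - 1)\<^sup>2 - sq D\<close>
    equals \<open>2 * Q ?P\<close>; multiplied by 82 it gives the coefficient 164.\<close>
  have lower: "Q ?P \<le> t" and upper: "t \<le> 164 * Q ?P + 121 * n" using sq t by linarith+
  have n1: "1 \<le> n" using i n by simp
  \<comment> \<open>\<open>n - 1 \<le> Q ?P + 1\<close> and \<open>1 \<le> Q ?P\<close> suffice.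
    Inserting this into \<open>upper\<close> gives the constant
    \<open>527 = 164 + 3 * 121\<close>.\<close>
  have small: "n \<le> 3 * Q ?P" if "Q ?P \<noteq> 0"
    using card_le_Suc_Q[OF _ part that] X m that by simp
  have "(n - 1)\<^sup>2 \<le> n\<^sup>2" by (simp add: power_mono)
  moreover have "n \<le> n\<^sup>2" using n1 by (simp add: power2_eq_square)
  ultimately have sqr: "Q ?P \<le> 527 * n\<^sup>2" "t \<le> 527 * n\<^sup>2" using sq upper by linarith+
  show "\<exists>t R M. halts_in prog (input_regs (card X) i) (input_mem (card X) A) t R M \<and>
    output_partition xs i R M = ?P \<and> 1 * real (Q ?P) \<le> real t \<and>
    (Q ?P \<noteq> 0 \<longrightarrow> real t \<le> 527 * real (Q ?P)) \<and> (Q ?P = 0 \<longrightarrow> real t \<le> 527 * real (card X)) \<and>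
    real (Q ?P) \<le> 527 * (real (card X))\<^sup>2 \<and> real t \<le> 527 * (real (card X))\<^sup>2"
    unfolding n_def[symmetric]
  proof (intro exI conjI impI)
    show "halts_in prog (input_regs n i) (input_mem n A) t R M" by (rule run(1))
    show "output_partition xs i R M = ?P" by (rule out)
    show "1 * real (Q ?P) \<le> real t" using lower by simp
    show "real t \<le> 527 * real (Q ?P)" if "Q ?P \<noteq> 0" using upper small[OF that] by linarith
    show "real t \<le> 527 * real n" if "Q ?P = 0" using upper that by linarith
    have "real (Q ?P) \<le> real (527 * n\<^sup>2)" "real t \<le> real (527 * n\<^sup>2)"
      using sqr by (simp_all only: of_nat_le_iff)
    then show "real (Q ?P) \<le> 527 * (real n)\<^sup>2" "real t \<le> 527 * (real n)\<^sup>2" by simp_all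
  qed
qed simp_all

end
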